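(* Let $\{X_\gamma\}_{\gamma>0}$ be $\mathbb{R}^d$-valued random variables and $\mathcal{E}\subset\mathbb{R}^d$ such that Assumptions (A) and (B) of the context hold, and consider the problem of estimating $p=p(\gamma)=P(\frac1\gamma X_\gamma\in\mathcal{E})$. Suppose that $A$ is a dominating set for $\mathcal{E}$ of finite cardinality with a unique most significant dominating point $a$, i.e. $I(a)<I(\tilde a)$ for all other $\tilde a\in A$. Let $\tilde P$ be the importance sampling distribution given by the exponential tilting towards $a$, $$\frac{d\tilde P}{dP}=e^{s_a^\top X_\gamma-\gamma\mu_\gamma(s_a)}.$$ Then the importance sampling estimator $Z=\mathbf 1\{\frac1\gamma X_\gamma\in\mathcal{E}\}\frac{dP}{d\tilde P}$ under $\tilde P$ is strongly probabilistically efficient.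
   Context: Setting. $\mu_\gamma(x)=\frac1\gamma\log E(e^{x^\top X_\gamma})$, $x\in\mathbb{R}^d$; $\mathcal{D}(f)=\{x:f(x)<\infty\}$; $S^\circ$, $\overline S$, $\partial S$ denote interior, closure, boundary. Assumption (A): (1) $\mu(x)=\lim_{\gamma\to\infty}\mu_\gamma(x)$ exists for every $x\in\mathbb{R}^d$, where $\infty$ is allowed both as a limit value and as an element of the sequence; (2) $0\in\mathcal{D}(\mu)^\circ$; (3) $\mu$ is essentially smooth: $\mathcal{D}(\mu)^\circ\neq\emptyset$, $\mu$ is differentiable on $\mathcal{D}(\mu)^\circ$, and $\mu$ is steep ($\|\nabla\mu(x_n)\|\to\infty$ whenever $x_n\in\mathcal{D}(\mu)^\circ$ converges to a boundary point of $\mathcal{D}(\mu)^\circ$). Rate function: $I(y)=\sup_{x\in\mathbb{R}^d}\{x^\top y-\mu(x)\}$; for a set $S$, $I(S)=\inf_{y\in S}I(y)$. Assumption (B): $\mathcal{E}\subset\mathbb{R}^d$ is a Borel set with $\overline{\mathcal{E}}=\overline{\mathcal{E}^\circ}$, $\mathcal{E}^\circ\cap\mathcal{D}(I)^\circ\neq\emptyset$ and $I(\mathcal{E})>0$. Dominating set: $A=\{a_1,\dots,a_r\}\subset\partial\mathcal{E}$ is a dominating set for $\mathcal{E}$ if (1) for each $i$, $a_i\in\mathcal{D}(I)^\circ$ and there is a unique $s_{a_i}\in\mathbb{R}^d$ with $\nabla\mu(s_{a_i})=a_i$; (2) $\mathcal{E}\subset\bigcup_{i=1}^r\{x:s_{a_i}^\top(x-a_i)\ge0\}$;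 (3) for every $i$, $A\setminus\{a_i\}$ does not satisfy (2). Points of $A$ are dominating points; $a$ is more significant than $a'$ if $I(a)<I(a')$. Tiltings are well defined whenever the corresponding $\mu_\gamma(s_{a})$ is finite, which holds for all large $\gamma$. Efficiency. For an estimator $\hat p$ of $p$ generated under $\tilde P$ and $\varepsilon>0$, let $\delta_\varepsilon(\hat p,p)=\inf\{\delta>0:\tilde P(|\hat p-p|>\delta p)\le\varepsilon\}$. Let $\hat p$ be the sample mean of $n=n(\gamma)$ independent replications of $Z$. $Z$ is strongly probabilistically efficient if one can choose $n$ subexponential in $-\log p$ (i.e. $\log n/(-\log p)\to0$ as $\gamma\to\infty$) such that for every $\varepsilon>0$, $\lim_{\gamma\to\infty}\delta_\varepsilon(\hat p,p)=0$. *)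

theory Defs
  imports "HOL-Probability.Probability"
begin

definition eff_domain :: "('v \<Rightarrow> ereal) \<Rightarrow> 'v set" where
  "eff_domain f = {x. f x < \<infinity>}"

text \<open>
  The gradient of an extended-real-valued function is only considered at points that have a
  neighbourhood on which the function is finite; the coercion to the reals, which sends the
  infinite values to 0, is therefore harmless.
\<close>

definition has_gradient :: "('v::real_inner \<Rightarrow> ereal) \<Rightarrow> 'v \<Rightarrow> 'v \<Rightarrow> bool" where
  "has_gradient f x g \<longleftrightarrow>
     (\<forall>\<^sub>F y in nhds x. \<bar>f y\<bar> \<noteq> \<infinity>) \<and> GDERIV (\<lambda>y. real_of_ereal (f y)) x :> g"

definition steep :: "('v::real_inner \<Rightarrow> ereal) \<Rightarrow> bool" where
  "steep f \<longleftrightarrow>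
     (\<forall>x g z. (\<forall>n::nat. x n \<in> interior (eff_domain f) \<and> has_gradient f (x n) (g n)) \<longrightarrow>
        x \<longlonglongrightarrow> z \<longrightarrow> z \<in> frontier (interior (eff_domain f)) \<longrightarrow>
        filterlim (\<lambda>n. norm (g n)) at_top sequentially)"

definition essentially_smooth :: "('v::real_inner \<Rightarrow> ereal) \<Rightarrow> bool" where
  "essentially_smooth f \<longleftrightarrow>
     interior (eff_domain f) \<noteq> {} \<and>
     (\<forall>x \<in> interior (eff_domain f). \<exists>g. has_gradient f x g) \<and>
     steep f"

definition ln_ennreal :: "ennreal \<Rightarrow> ereal" where
  "ln_ennreal u =
     (if u = 0 then - \<infinity> else if u = \<infinity> then \<infinity> else ereal (ln (enn2real u)))"

definition scaled_cgf ::
    "'a measure \<Rightarrow> (real \<Rightarrow> 'a \<Rightarrow> 'v::real_inner) \<Rightarrow> real \<Rightarrow> 'v \<Rightarrow> ereal" where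
  "scaled_cgf M X \<gamma> x =
     ereal (1 / \<gamma>) * ln_ennreal (\<integral>\<^sup>+ \<omega>. ennreal (exp (x \<bullet> X \<gamma> \<omega>)) \<partial>M)"

definition assumption_A ::
    "'a measure \<Rightarrow> (real \<Rightarrow> 'a \<Rightarrow> 'v::real_inner) \<Rightarrow> ('v \<Rightarrow> ereal) \<Rightarrow> bool" where
  "assumption_A M X \<mu> \<longleftrightarrow>
     (\<forall>x. ((\<lambda>\<gamma>. scaled_cgf M X \<gamma> x) \<longlongrightarrow> \<mu> x) at_top) \<and>
     0 \<in> interior (eff_domain \<mu>) \<and>
     essentially_smooth \<mu>"

definition rate :: "('v::real_inner \<Rightarrow> ereal) \<Rightarrow> 'v \<Rightarrow> ereal" where
  "rate \<mu> y = (SUP x. ereal (x \<bullet> y) - \<mu> x)"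

definition rate_set :: "('v::real_inner \<Rightarrow> ereal) \<Rightarrow> 'v set \<Rightarrow> ereal" where
  "rate_set \<mu> S = (INF y\<in>S. rate \<mu> y)"

definition assumption_B :: "('v::real_inner \<Rightarrow> ereal) \<Rightarrow> 'v set \<Rightarrow> bool" where
  "assumption_B \<mu> E \<longleftrightarrow>
     E \<in> sets borel \<and>
     closure E = closure (interior E) \<and>
     interior E \<inter> interior (eff_domain (rate \<mu>)) \<noteq> {} \<and>
     rate_set \<mu> E > 0"

definition tilt :: "('v::real_inner \<Rightarrow> ereal) \<Rightarrow> 'v \<Rightarrow> 'v" where
  "tilt \<mu> a = (THE s. has_gradient \<mu> s a)"

definition covered_by_halfspaces ::
    "('v::real_inner \<Rightarrow> ereal) \<Rightarrow> 'v set \<Rightarrow> 'v set \<Rightarrow> bool" where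
  "covered_by_halfspaces \<mu> E A \<longleftrightarrow> E \<subseteq> (\<Union>a\<in>A. {x. tilt \<mu> a \<bullet> (x - a) \<ge> 0})"

definition dominating_set :: "('v::real_inner \<Rightarrow> ereal) \<Rightarrow> 'v set \<Rightarrow> 'v set \<Rightarrow> bool" where
  "dominating_set \<mu> E A \<longleftrightarrow>
     finite A \<and> A \<subseteq> frontier E \<and>
     (\<forall>a\<in>A. a \<in> interior (eff_domain (rate \<mu>)) \<and> (\<exists>!s. has_gradient \<mu> s a)) \<and>
     covered_by_halfspaces \<mu> E A \<and>
     (\<forall>a\<in>A. \<not> covered_by_halfspaces \<mu> E (A - {a}))"

definition rare_event_prob ::
    "'a measure \<Rightarrow> (real \<Rightarrow> 'a \<Rightarrow> 'v::real_inner) \<Rightarrow> 'v set \<Rightarrow> real \<Rightarrow> real" where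
  "rare_event_prob M X E \<gamma> = measure M {\<omega> \<in> space M. (1 / \<gamma>) *\<^sub>R X \<gamma> \<omega> \<in> E}"

text \<open>
  The tilted measure is a probability measure whenever the scaled cumulant generating function is
  finite at \<^term>\<open>s\<close>; otherwise the definition yields a meaningless measure.
\<close>

definition tilted_measure ::
    "'a measure \<Rightarrow> (real \<Rightarrow> 'a \<Rightarrow> 'v::real_inner) \<Rightarrow> 'v \<Rightarrow> real \<Rightarrow> 'a measure" where
  "tilted_measure M X s \<gamma> =
     density M (\<lambda>\<omega>. ennreal (exp (s \<bullet> X \<gamma> \<omega> - \<gamma> * real_of_ereal (scaled_cgf M X \<gamma> s))))"

text \<open>Note the argument order: \<^term>\<open>RN_deriv Q M\<close> is the density of \<^term>\<open>M\<close> with respect to \<^term>\<open>Q\<close>.\<close>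

definition importance_estimator ::
    "'a measure \<Rightarrow> 'a measure \<Rightarrow> (real \<Rightarrow> 'a \<Rightarrow> 'v::real_inner) \<Rightarrow> 'v set \<Rightarrow> real \<Rightarrow> 'a \<Rightarrow> real" where
  "importance_estimator M Q X E \<gamma> \<omega> =
     indicator E ((1 / \<gamma>) *\<^sub>R X \<gamma> \<omega>) * enn2real (RN_deriv Q M \<omega>)"

definition sample_mean :: "('a \<Rightarrow> real) \<Rightarrow> nat \<Rightarrow> (nat \<Rightarrow> 'a) \<Rightarrow> real" where
  "sample_mean Z n \<omega> = (\<Sum>i<n. Z (\<omega> i)) / real n"

text \<open>
  The replications are the coordinates of the \<^term>\<open>n\<close>-fold product of the sampling
  distribution \<^term>\<open>Q\<close>. The infimum is taken in the extended reals, so that it is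
  infinite if no \<^term>\<open>\<delta>\<close> qualifies.
\<close>

definition rel_error ::
    "'a measure \<Rightarrow> ('a \<Rightarrow> real) \<Rightarrow> nat \<Rightarrow> real \<Rightarrow> real \<Rightarrow> ereal" where
  "rel_error Q Z n p \<epsilon> =
     Inf (ereal ` {\<delta>. \<delta> > 0 \<and>
       measure (\<Pi>\<^sub>M i\<in>{..<n}. Q)
         {\<omega> \<in> space (\<Pi>\<^sub>M i\<in>{..<n}. Q). \<bar>sample_mean Z n \<omega> - p\<bar> > \<delta> * p} \<le> \<epsilon>})"

definition strongly_prob_efficient ::
    "(real \<Rightarrow> 'a measure) \<Rightarrow> (real \<Rightarrow> 'a \<Rightarrow> real) \<Rightarrow> (real \<Rightarrow> real) \<Rightarrow> bool" where
  "strongly_prob_efficient Q Z p \<longleftrightarrow>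
     (\<exists>n :: real \<Rightarrow> nat.
        (\<forall>\<gamma>. n \<gamma> \<ge> 1) \<and>
        ((\<lambda>\<gamma>. ln (real (n \<gamma>)) / (- ln (p \<gamma>))) \<longlongrightarrow> 0) at_top \<and>
        (\<forall>\<epsilon>>0. ((\<lambda>\<gamma>. rel_error (Q \<gamma>) (Z \<gamma>) (n \<gamma>) (p \<gamma>) \<epsilon>) \<longlongrightarrow> 0) at_top))"

end

theory Submission
  imports Defs "HOL-Real_Asymp.Real_Asymp"
begin

text \<open>
  Write \<open>s\<close> for the tilt of \<open>a\<close>, \<open>J b\<close> for the rate at a dominating point \<open>b\<close> and \<open>H b\<close> for its
  half-space, and let \<open>Q\<close> be the distribution tilted towards \<open>a\<close>. The estimator \<open>Z\<close> may well have a
  large second moment, because on the part of \<open>E\<close> outside \<open>H a\<close> its weight is uncontrolled.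
  Probabilistic efficiency survives since that part matters neither to \<open>p\<close> nor to the sample:

  \<^item> \<open>E\<close> is covered by the half-spaces, so off the bad set \<open>B\<close>, the union of the \<open>H b\<close> with \<open>b \<noteq> a\<close>,
    the event lies in \<open>H a\<close>. There \<open>Z\<close> is at most its value on the bounding hyperplane, which is
    \<open>exp (- \<gamma> * J a)\<close> up to a subexponential factor.
  \<^item> The lower bound \<open>p \<ge> exp (- \<gamma> * (J a + \<eta>))\<close> holds for large \<open>\<gamma>\<close> (\<open>rare_event_lower_bound\<close>), so off \<open>B\<close>
    the ratio \<open>Z / p\<close> is bounded by a subexponential factor \<open>R\<close>.
  \<^item> Chernoff's bound gives \<open>H b\<close> at most the probability \<open>exp (- \<gamma> * \<theta>)\<close> for every \<open>\<theta> < J b\<close>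
    (\<open>half_space_prob\<close>). As \<open>J a < J b\<close>, discarding \<open>B\<close> changes \<open>p\<close> only by an exponentially small fraction.
  \<^item> The point \<open>a\<close> is in no \<open>H b\<close> with \<open>b \<noteq> a\<close>, because the rate of \<open>a\<close> would then be at least \<open>J b\<close>. As
    \<open>Q\<close> concentrates at \<open>a\<close>, the set \<open>B\<close> has exponentially small \<open>Q\<close>-probability
    (\<open>tilted_tail_decay\<close>). Hence a subexponential sample avoids \<open>B\<close> with high probability.

  On the sample the estimator is then a mean of bounded variables, and a number of replications
  that exceeds the square of \<open>R\<close> but remains subexponential makes it concentrate at \<open>p\<close>
  (\<open>strongly_prob_efficientI\<close>). Positivity of \<open>J a\<close> makes \<open>- ln p\<close> grow linearly in \<open>\<gamma>\<close>, so subexponential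
  in \<open>\<gamma>\<close> is subexponential in \<open>- ln p\<close>.

  The lower bound rests on a local argument of convex analysis (\<open>gradients_near\<close>): since \<open>s\<close>
  is the only point with gradient \<open>a\<close>, every point near \<open>a\<close> is itself a gradient, and its rate is close
  to \<open>J a\<close>. Interior points of \<open>E\<close> near \<open>a\<close> can thus be reached by tilting.
\<close>

section \<open>Gradients of convex extended-real functions\<close>

text \<open>
  Differentiability enters mostly through this one-sided linear bound along a ray.
  Together with convexity it gives the global support inequality, applied to the limiting
  cumulant generating function it gives exponential bounds for tilted measures, and it shows that
  a local maximiser of \<open>z \<bullet> y - f z\<close> can only have gradient \<^term>\<open>y\<close>.
\<close>

lemma gradient_less:
  assumes f: "has_gradient f s y" and c: "v \<bullet> y < c"
  shows "\<forall>\<^sub>F t in at_right 0. f (s + t *\<^sub>R v) < ereal (real_of_ereal (f s) + t * c)"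
proof -
  let ?g = "\<lambda>x. real_of_ereal (f x)"
  have line: "((\<lambda>t. s + t *\<^sub>R v) \<longlongrightarrow> s) (at_right (0::real))"
    by (auto intro!: tendsto_eq_intros)
  have fin: "\<forall>\<^sub>F t in at_right 0. \<bar>f (s + t *\<^sub>R v)\<bar> \<noteq> \<infinity>"
    using f line unfolding has_gradient_def by (auto dest: eventually_compose_filterlim)
  have "((\<lambda>t. ?g (s + t *\<^sub>R v)) has_derivative (\<lambda>h. (h *\<^sub>R v) \<bullet> y)) (at (0::real))"
  proof -
    have d: "(?g has_derivative (\<lambda>h. h \<bullet> y)) (at (s + 0 *\<^sub>R v))"
      using f by (simp add: has_gradient_def gderiv_def)
    have "((\<lambda>t::real. s + t *\<^sub>R v) has_derivative (\<lambda>h. h *\<^sub>R v)) (at 0)"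
      by (auto intro!: derivative_eq_intros)
    from has_derivative_compose[OF this d] show ?thesis .
  qed
  then have "((\<lambda>t. ?g (s + t *\<^sub>R v)) has_real_derivative v \<bullet> y) (at 0)"
    unfolding has_field_derivative_def by (rule has_derivative_eq_rhs) (auto simp: mult.commute)
  then have "((\<lambda>t. (?g (s + t *\<^sub>R v) - ?g s) / t) \<longlongrightarrow> v \<bullet> y) (at 0)"
    by (simp add: DERIV_def)
  then have "((\<lambda>t. (?g (s + t *\<^sub>R v) - ?g s) / t) \<longlongrightarrow> v \<bullet> y) (at_right 0)"
    by (rule tendsto_mono[OF at_le, rotated]) simp
  from order_tendstoD(2)[OF this c] fin eventually_at_right_less[of 0]
  show ?thesis
  proof eventually_elim
    case (elim t)
    then have "?g (s + t *\<^sub>R v) - ?g s < c * t" 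
      by (simp add: pos_divide_less_eq)
    then show ?case using elim
      by (cases "f (s + t *\<^sub>R v)") (auto simp: algebra_simps)
  qed
qed

lemma has_gradient_finite:
  assumes "has_gradient f s y"
  shows "f s = ereal (real_of_ereal (f s))"
proof -
  have "\<forall>\<^sub>F z in nhds s. \<bar>f z\<bar> \<noteq> \<infinity>"
    using assms by (simp add: has_gradient_def)
  then have "\<bar>f s\<bar> \<noteq> \<infinity>" by (rule eventually_nhds_x_imp_x)
  then show ?thesis by (simp add: ereal_real)
qed

text \<open>
  Convexity for functions that may take both infinite values: bounding by real numbers avoids
  the ill-defined sum of the two infinities.
\<close>

definition epi_convex :: "('v::real_vector \<Rightarrow> ereal) \<Rightarrow> bool" where
  "epi_convex f \<longleftrightarrow> (\<forall>x y \<alpha> \<beta> t. f x \<le> ereal \<alpha> \<longrightarrow> f y \<le> ereal \<beta> \<longrightarrow> 0 \<le> t \<longrightarrow> t \<le> 1 \<longrightarrow>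
     f ((1 - t) *\<^sub>R x + t *\<^sub>R y) \<le> ereal ((1 - t) * \<alpha> + t * \<beta>))"

text \<open>
  Convexity lets one compare \<^term>\<open>f s\<close> with the values at \<^term>\<open>x\<close> and at a point slightly beyond
  \<^term>\<open>s\<close> on the line from \<^term>\<open>x\<close> through \<^term>\<open>s\<close>; the latter value is bounded to first order by the
  gradient.
\<close>

lemma gradient_supports:
  assumes conv: "epi_convex f" and grad: "has_gradient f s y" and x: "f x \<le> ereal \<beta>"
  shows "x \<bullet> y - \<beta> \<le> s \<bullet> y - real_of_ereal (f s)"
proof -
  let ?m = "real_of_ereal (f s)"
  have "?m - \<beta> \<le> c" if c: "(s - x) \<bullet> y < c" for c
  proof -
    obtain t where t: "0 < t" "f (s + t *\<^sub>R (s - x)) < ereal (?m + t * c)"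
      using eventually_happens[OF eventually_conj[OF eventually_at_right_less[of 0] gradient_less[OF grad c]]]
      by (auto simp: trivial_limit_at_right_real)
    \<comment> \<open>the weight with which \<^term>\<open>s\<close> is a convex combination of the overshoot and \<^term>\<open>x\<close>\<close>
    define r where "r = t / (1 + t)"
    have r: "0 \<le> r" "r \<le> 1" "1 - r = 1 / (1 + t)" using t by (auto simp: r_def field_simps)
    have "(1 - r) *\<^sub>R (s + t *\<^sub>R (s - x)) + r *\<^sub>R x = ((1 - r) * (1 + t)) *\<^sub>R s + (r - (1 - r) * t) *\<^sub>R x"
      by (simp add: algebra_simps)
    also have "\<dots> = s" using t by (simp add: r(3)) (simp add: r_def)
    finally have "f s \<le> ereal ((1 - r) * (?m + t * c) + r * \<beta>)"
      using conv t x r(1,2) unfolding epi_convex_def by (metis less_imp_le)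
    then have "?m \<le> (1 - r) * (?m + t * c) + r * \<beta>"
      using has_gradient_finite[OF grad] by (metis ereal_less_eq(3))
    also have "\<dots> = (?m + t * c + t * \<beta>) / (1 + t)"
      by (simp add: r(3)) (simp add: r_def add_divide_distrib)
    finally have "t * (?m - \<beta>) \<le> t * c"
      using t by (simp add: field_simps)
    then show ?thesis using t by simp
  qed
  then have "?m - \<beta> \<le> (s - x) \<bullet> y"
    by (rule dense_ge)
  then show ?thesis by (simp add: inner_diff_left)
qed

lemma rate_at_gradient:
  assumes "epi_convex f" "has_gradient f s y"
  shows "rate f y = ereal (s \<bullet> y - real_of_ereal (f s))"
  unfolding rate_def
proof (rule antisym)
  show "(SUP x. ereal (x \<bullet> y) - f x) \<le> ereal (s \<bullet> y - real_of_ereal (f s))"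
  proof (rule SUP_least)
    fix x
    show "ereal (x \<bullet> y) - f x \<le> ereal (s \<bullet> y - real_of_ereal (f s))"
    proof (cases "f x")
      case (real r)
      then show ?thesis using gradient_supports[OF assms, of x r] by simp
    next
      case MInf
      then have "x \<bullet> y - \<beta> \<le> s \<bullet> y - real_of_ereal (f s)" for \<beta>
        by (intro gradient_supports[OF assms]) simp
      \<comment> \<open>a value of \<^term>\<open>\<beta>\<close> low enough to refute this bound\<close>
      from this[of "x \<bullet> y - (s \<bullet> y - real_of_ereal (f s)) - 1"] show ?thesis by simp
    qed simp
  qed
  show "ereal (s \<bullet> y - real_of_ereal (f s)) \<le> (SUP x. ereal (x \<bullet> y) - f x)"
    by (rule SUP_upper2[of s]) (use has_gradient_finite[OF assms(2)] in \<open>auto simp: ereal_minus(1)[symmetric] simp del: ereal_minus\<close>)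
qed

lemma gradient_at_local_max:
  assumes grad: "has_gradient f x g"
    and max: "\<forall>\<^sub>F z in nhds x. z \<bullet> y - real_of_ereal (f z) \<le> x \<bullet> y - real_of_ereal (f x)"
  shows "g = y"
proof (rule ccontr)
  assume "g \<noteq> y"
  define v where "v = y - g"
  have "v \<noteq> 0" using \<open>g \<noteq> y\<close> by (auto simp: v_def)
  then have "0 < v \<bullet> v" by simp
  moreover have "v \<bullet> v = v \<bullet> y - v \<bullet> g"
    unfolding inner_diff_right[symmetric] v_def ..
  ultimately have less: "v \<bullet> g < v \<bullet> y" by linarith
  have line: "((\<lambda>t. x + t *\<^sub>R v) \<longlongrightarrow> x) (at_right (0::real))"
    by (auto intro!: tendsto_eq_intros)
  have "\<forall>\<^sub>F z in nhds x. \<bar>f z\<bar> \<noteq> \<infinity>"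
    using grad by (simp add: has_gradient_def)
  with max have "\<forall>\<^sub>F z in nhds x. z \<bullet> y - real_of_ereal (f z) \<le> x \<bullet> y - real_of_ereal (f x) \<and> \<bar>f z\<bar> \<noteq> \<infinity>"
    by eventually_elim simp
  then have "\<forall>\<^sub>F t in at_right 0. (x + t *\<^sub>R v) \<bullet> y - real_of_ereal (f (x + t *\<^sub>R v)) \<le> x \<bullet> y - real_of_ereal (f x)
      \<and> \<bar>f (x + t *\<^sub>R v)\<bar> \<noteq> \<infinity>"
    using line by (rule eventually_compose_filterlim)
  with gradient_less[OF grad less] have "\<forall>\<^sub>F t in at_right (0::real). False"
  proof eventually_elim
    case (elim t)
    then show ?case
      by (cases "f (x + t *\<^sub>R v)") (auto simp: inner_add_left)
  qed
  then show False by (simp add: trivial_limit_at_right_real)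
qed

text \<open>
  If \<^term>\<open>a\<close> is the gradient at a single point \<^term>\<open>s\<close>, then the gradients cover a neighbourhood of \<^term>\<open>a\<close>.
  Indeed the concave function \<open>x \<bullet> a - f x\<close> is maximal exactly at \<^term>\<open>s\<close>, hence it is
  smaller by a fixed amount on a sphere around \<^term>\<open>s\<close>. Moving \<^term>\<open>a\<close> to a nearby \<^term>\<open>y\<close> changes the
  function too little for the maximum over the closed ball to reach the sphere, and an interior
  maximiser has gradient \<^term>\<open>y\<close>. The bound in the second conjunct stands in for the continuity of
  the rate function at \<^term>\<open>a\<close>.
\<close>

lemma gradients_near:
  fixes f :: "'v::euclidean_space \<Rightarrow> ereal"
  assumes conv: "epi_convex f"
    and diff: "\<And>x. x \<in> interior (eff_domain f) \<Longrightarrow> \<exists>g. has_gradient f x g"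
    and s: "has_gradient f s a" and uniq: "\<And>x. has_gradient f x a \<Longrightarrow> x = s"
  obtains \<rho> K where "0 < \<rho>" "0 < K"
    "\<And>y. norm (y - a) < \<rho> \<Longrightarrow>
       \<exists>x. has_gradient f x y \<and>
           x \<bullet> y - real_of_ereal (f x) \<le> s \<bullet> a - real_of_ereal (f s) + K * norm (y - a)"
proof -
  let ?m = "\<lambda>x. real_of_ereal (f x)"
  define \<phi> where "\<phi> y x = x \<bullet> y - ?m x" for y x
  obtain r where r: "0 < r" and fin: "\<And>x. dist x s < 2 * r \<Longrightarrow> \<bar>f x\<bar> \<noteq> \<infinity>"
  proof -
    have "\<forall>\<^sub>F x in nhds s. \<bar>f x\<bar> \<noteq> \<infinity>"
      using s by (simp add: has_gradient_def)
    then obtain e where "0 < e" "\<And>x. dist x s < e \<Longrightarrow> \<bar>f x\<bar> \<noteq> \<infinity>"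
      unfolding eventually_nhds_metric by blast
    then show ?thesis using that[of "e / 2"] by simp
  qed
  have ball: "ball s (2 * r) \<subseteq> interior (eff_domain f)"
  proof (rule interior_maximal)
    show "ball s (2 * r) \<subseteq> eff_domain f"
    proof
      fix x assume "x \<in> ball s (2 * r)"
      then have "\<bar>f x\<bar> \<noteq> \<infinity>" by (intro fin) (simp add: dist_commute)
      then show "x \<in> eff_domain f" by (cases "f x") (simp_all add: eff_domain_def)
    qed
  qed simp
  have sub: "cball s r \<subseteq> ball s (2 * r)" using r by auto
  have cont_m: "continuous_on (cball s r) ?m"
  proof (rule continuous_at_imp_continuous_on, rule ballI)
    fix x assume "x \<in> cball s r"
    then have "x \<in> interior (eff_domain f)" using ball sub by auto
    then obtain g where "has_gradient f x g" using diff by auto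
    then show "isCont ?m x"
      unfolding has_gradient_def gderiv_def using has_derivative_continuous by auto
  qed
  then have cont: "continuous_on (cball s r) (\<phi> y)" for y
    unfolding \<phi>_def by (intro continuous_intros)
  have glob: "\<phi> a x \<le> \<phi> a s" if "x \<in> ball s (2 * r)" for x
  proof -
    have "f x = ereal (?m x)" using fin[of x] that by (auto simp: dist_commute ereal_real)
    then show ?thesis using gradient_supports[OF conv s, of x "?m x"] by (simp add: \<phi>_def)
  qed
  have max_gradient: "has_gradient f x y"
    if x: "x \<in> ball s (2 * r)" and max: "\<And>z. z \<in> U \<Longrightarrow> \<phi> y z \<le> \<phi> y x" and U: "open U" "x \<in> U" for x y U
  proof -
    obtain g where g: "has_gradient f x g" using diff ball x by blast
    have "\<forall>\<^sub>F z in nhds x. \<phi> y z \<le> \<phi> y x"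
      using max U eventually_nhds by blast
    then have "g = y" using g unfolding \<phi>_def by (intro gradient_at_local_max)
    then show ?thesis using g by simp
  qed
  obtain \<kappa> where \<kappa>: "0 < \<kappa>" "\<And>x. x \<in> sphere s r \<Longrightarrow> \<phi> a x \<le> \<phi> a s - \<kappa>"
  proof (cases "sphere s r = {}")
    case True
    then show ?thesis using that[of 1] by auto
  next
    case False
    have "continuous_on (sphere s r) (\<phi> a)"
      using cont sphere_cball by (rule continuous_on_subset)
    from continuous_attains_sup[OF compact_sphere False this]
    obtain x where x: "x \<in> sphere s r" "\<And>z. z \<in> sphere s r \<Longrightarrow> \<phi> a z \<le> \<phi> a x" by auto
    have xb: "x \<in> ball s (2 * r)" using x(1) r by auto
    have "\<phi> a x < \<phi> a s"
    proof (rule ccontr)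
      assume "\<not> \<phi> a x < \<phi> a s"
      then have "\<phi> a z \<le> \<phi> a x" if "z \<in> ball s (2 * r)" for z
        using glob[OF that] by linarith
      then have "has_gradient f x a"
        using max_gradient[OF xb, of "ball s (2 * r)"] xb by auto
      then have "x = s" by (rule uniq)
      then show False using x(1) r by simp
    qed
    then show ?thesis using that[of "\<phi> a s - \<phi> a x"] x(2) by auto
  qed
  show ?thesis
  proof (rule that)
    show "0 < \<kappa> / r" using \<kappa> r by simp
    show "0 < norm s + r" using r by (simp add: add_nonneg_pos)
    fix y assume y: "norm (y - a) < \<kappa> / r"
    have shift: "\<phi> y x = \<phi> a x + x \<bullet> (y - a)" for x
      by (simp add: \<phi>_def inner_diff_right)
    obtain x where x: "x \<in> cball s r" "\<And>z. z \<in> cball s r \<Longrightarrow> \<phi> y z \<le> \<phi> y x"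
      using continuous_attains_sup[OF compact_cball _ cont[of y]] r by auto
    have "x \<notin> sphere s r"
    proof
      assume xs: "x \<in> sphere s r"
      have "\<phi> y s \<le> \<phi> y x" using x(2)[of s] r by simp
      then have "\<kappa> \<le> (x - s) \<bullet> (y - a)"
        using \<kappa>(2)[OF xs] by (simp add: shift inner_diff_left)
      also have "\<dots> \<le> norm (x - s) * norm (y - a)" by (rule norm_cauchy_schwarz)
      also have "norm (x - s) = r" using xs by (simp add: dist_norm norm_minus_commute)
      also have "r * norm (y - a) < \<kappa>" using y r by (simp add: field_simps)
      finally show False by simp
    qed
    then have xb: "x \<in> ball s r" using x(1) by (auto simp: less_le)
    have "has_gradient f x y"
    proof (rule max_gradient)
      show "x \<in> ball s (2 * r)" using x(1) sub by auto
      show "\<phi> y z \<le> \<phi> y x" if "z \<in> ball s r" for z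
        using x(2) that by simp
    qed (use xb in simp_all)
    moreover have "\<phi> y x \<le> \<phi> a s + (norm s + r) * norm (y - a)"
    proof -
      have "x \<bullet> (y - a) \<le> norm x * norm (y - a)" by (rule norm_cauchy_schwarz)
      also have "norm x \<le> norm s + r"
        using x(1) norm_triangle_sub[of x s] by (simp add: dist_norm norm_minus_commute)
      finally have "x \<bullet> (y - a) \<le> (norm s + r) * norm (y - a)" 
        by (simp add: mult_right_mono)
      moreover have "\<phi> a x \<le> \<phi> a s" using glob x(1) sub by auto
      ultimately show ?thesis by (simp add: shift)
    qed
    ultimately show "\<exists>x. has_gradient f x y \<and>
        x \<bullet> y - ?m x \<le> s \<bullet> a - ?m s + (norm s + r) * norm (y - a)"
      by (auto simp: \<phi>_def)
  qed
qed

section \<open>Exponentially decaying functions\<close>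

definition exp_decaying :: "(real \<Rightarrow> real) \<Rightarrow> bool" where
  "exp_decaying f \<longleftrightarrow> (\<exists>\<kappa>>0. \<forall>\<^sub>F \<gamma> in at_top. f \<gamma> \<le> exp (- \<kappa> * \<gamma>))"

lemma exp_decaying_mono:
  assumes "exp_decaying g" "\<forall>\<^sub>F \<gamma> in at_top. f \<gamma> \<le> g \<gamma>"
  shows "exp_decaying f"
proof -
  obtain \<kappa> where \<kappa>: "\<kappa> > 0" "\<forall>\<^sub>F \<gamma> in at_top. g \<gamma> \<le> exp (- \<kappa> * \<gamma>)"
    using assms(1) by (auto simp: exp_decaying_def)
  from assms(2) \<kappa>(2) have "\<forall>\<^sub>F \<gamma> in at_top. f \<gamma> \<le> exp (- \<kappa> * \<gamma>)"
    by eventually_elim simp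
  with \<kappa>(1) show ?thesis by (auto simp: exp_decaying_def)
qed

lemma exp_decaying_add:
  assumes "exp_decaying f" "exp_decaying g"
  shows "exp_decaying (\<lambda>\<gamma>. f \<gamma> + g \<gamma>)"
proof -
  obtain \<kappa> \<kappa>' where k: "\<kappa> > 0" "\<kappa>' > 0" "\<forall>\<^sub>F \<gamma> in at_top. f \<gamma> \<le> exp (- \<kappa> * \<gamma>)"
    "\<forall>\<^sub>F \<gamma> in at_top. g \<gamma> \<le> exp (- \<kappa>' * \<gamma>)"
    using assms by (auto simp: exp_decaying_def)
  define k where "k = min \<kappa> \<kappa>' / 2"
  have k0: "k > 0" "2 * k \<le> \<kappa>" "2 * k \<le> \<kappa>'" using k by (auto simp: k_def)
  have "\<forall>\<^sub>F \<gamma> in at_top. 2 * exp (- (2 * k) * \<gamma>) \<le> exp (- k * \<gamma>)"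
    using k0 by real_asymp
  then have "\<forall>\<^sub>F \<gamma> in at_top. f \<gamma> + g \<gamma> \<le> exp (- k * \<gamma>)"
    using k(3,4) eventually_gt_at_top[of 0]
  proof eventually_elim
    case (elim \<gamma>)
    have "exp (- \<kappa> * \<gamma>) \<le> exp (- (2 * k) * \<gamma>)" "exp (- \<kappa>' * \<gamma>) \<le> exp (- (2 * k) * \<gamma>)"
      using k0 elim by auto
    then show ?case using elim by linarith
  qed
  then show ?thesis using k0 by (auto simp: exp_decaying_def)
qed

lemma exp_decaying_sum:
  assumes "finite F" "\<And>i. i \<in> F \<Longrightarrow> exp_decaying (f i)"
  shows "exp_decaying (\<lambda>\<gamma>. \<Sum>i\<in>F. f i \<gamma>)"
  using assms
proof (induction F rule: finite_induct)
  case empty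
  then show ?case unfolding exp_decaying_def by (auto intro: exI[of _ 1])
next
  case (insert i F)
  then show ?case by (auto intro: exp_decaying_add)
qed

lemma exp_decaying_eventually_less:
  assumes "exp_decaying f" "0 < c"
  shows "\<forall>\<^sub>F \<gamma> in at_top. f \<gamma> < c"
proof -
  obtain \<kappa> where \<kappa>: "\<kappa> > 0" "\<forall>\<^sub>F \<gamma> in at_top. f \<gamma> \<le> exp (- \<kappa> * \<gamma>)"
    using assms by (auto simp: exp_decaying_def)
  have "((\<lambda>\<gamma>. exp (- \<kappa> * \<gamma>)) \<longlongrightarrow> 0) at_top"
    using \<kappa>(1) by real_asymp
  from order_tendstoD(2)[OF this \<open>0 < c\<close>] \<kappa>(2) show ?thesis
    by eventually_elim simp
qed

section \<open>Sample means of variables bounded off a small set\<close>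

lemma indep_vars_PiM_coordinates:
  assumes "prob_space Q" "I \<noteq> {}"
  shows "prob_space.indep_vars (\<Pi>\<^sub>M i\<in>I. Q) (\<lambda>_. Q) (\<lambda>i \<omega>. \<omega> i) I"
proof -
  interpret P: prob_space "\<Pi>\<^sub>M i\<in>I. Q"
    by (intro prob_space_PiM assms)
  have "distr (\<Pi>\<^sub>M i\<in>I. Q) (\<Pi>\<^sub>M i\<in>I. Q) (\<lambda>\<omega>. \<lambda>i\<in>I. \<omega> i) = distr (\<Pi>\<^sub>M i\<in>I. Q) (\<Pi>\<^sub>M i\<in>I. Q) (\<lambda>\<omega>. \<omega>)"
    by (intro distr_cong) (auto simp: space_PiM PiE_def extensional_restrict)
  also have "\<dots> = (\<Pi>\<^sub>M i\<in>I. distr (\<Pi>\<^sub>M i\<in>I. Q) Q (\<lambda>\<omega>. \<omega> i))"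
    by (subst distr_id, intro PiM_cong refl, subst distr_PiM_component) (auto simp: assms)
  finally show ?thesis
    by (subst P.indep_vars_iff_distr_eq_PiM') (auto simp: assms)
qed

text \<open>
  \<^term>\<open>Z\<close> itself need not have a useful variance under \<^term>\<open>Q\<close>. Outside a bad set \<^term>\<open>B\<close> it is at most
  \<^term>\<open>C * p\<close>, so it is replaced by 0 on \<^term>\<open>B\<close>: either some replication falls into \<^term>\<open>B\<close>, which
  the union bound controls, or the sample mean is that of bounded variables whose mean is within
  \<^term>\<open>\<delta> / 2 * p\<close> of \<^term>\<open>p\<close>, and Hoeffding's inequality applies to the remaining
  deviation \<^term>\<open>\<delta> / 2 * p\<close>.
\<close>

lemma sample_mean_error:
  fixes Z :: "'a \<Rightarrow> real"
  assumes Q: "prob_space Q" and Z[measurable]: "Z \<in> borel_measurable Q" and B[measurable]: "B \<in> sets Q"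
    and C: "0 < C" and p: "0 < p" and \<delta>: "0 < \<delta>" and n: "1 \<le> n"
    and bounded: "\<And>\<omega>. \<omega> \<in> space Q - B \<Longrightarrow> 0 \<le> Z \<omega> \<and> Z \<omega> \<le> C * p"
    and bias: "\<bar>(\<integral>\<omega>. indicator (space Q - B) \<omega> * Z \<omega> \<partial>Q) - p\<bar> \<le> \<delta> / 2 * p"
  shows "measure (\<Pi>\<^sub>M i\<in>{..<n}. Q)
           {\<omega> \<in> space (\<Pi>\<^sub>M i\<in>{..<n}. Q). \<bar>sample_mean Z n \<omega> - p\<bar> > \<delta> * p}
         \<le> n * measure Q B + 2 * exp (- (real n * \<delta>\<^sup>2 / (2 * C\<^sup>2)))"
proof -
  let ?P = "\<Pi>\<^sub>M i\<in>{..<n}. Q"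
  define W where "W \<omega> = indicator (space Q - B) \<omega> * Z \<omega>" for \<omega>
  define w where "w = (\<integral>\<omega>. W \<omega> \<partial>Q)"
  interpret Q: prob_space Q by fact
  interpret P: prob_space ?P by (intro prob_space_PiM Q)
  have W[measurable]: "W \<in> borel_measurable Q" unfolding W_def by measurable
  have W_bounds: "0 \<le> W \<omega> \<and> W \<omega> \<le> C * p" for \<omega>
    using bounded[of \<omega>] C p by (auto simp: W_def indicator_def)
  have marginal: "distr ?P Q (\<lambda>\<omega>. \<omega> i) = Q" if "i < n" for i
    using distr_PiM_component[of "{..<n}" "\<lambda>_. Q" i] Q that by auto
  have marginal_B: "P.prob {\<omega> \<in> space ?P. \<omega> i \<in> B} = Q.prob B" if "i < n" for i
  proof -
    have "Q.prob B = measure (distr ?P Q (\<lambda>\<omega>. \<omega> i)) B"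
      using marginal[OF that] by simp
    also have "\<dots> = P.prob ((\<lambda>\<omega>. \<omega> i) -` B \<inter> space ?P)"
      by (intro measure_distr) (use that in auto)
    also have "(\<lambda>\<omega>. \<omega> i) -` B \<inter> space ?P = {\<omega> \<in> space ?P. \<omega> i \<in> B}" by auto
    finally show ?thesis by simp
  qed
  have mean: "P.expectation (\<lambda>\<omega>. W (\<omega> i)) = w" if "i < n" for i
  proof -
    have "w = (\<integral>\<omega>. W \<omega> \<partial>distr ?P Q (\<lambda>\<omega>. \<omega> i))"
      using marginal[OF that] by (simp add: w_def)
    also have "\<dots> = P.expectation (\<lambda>\<omega>. W (\<omega> i))"
      by (intro integral_distr) (use that in auto)
    finally show ?thesis by simp
  qed
  have "P.indep_vars (\<lambda>_. borel) (\<lambda>i \<omega>. W (\<omega> i)) {..<n}"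
    by (rule P.indep_vars_compose2[OF indep_vars_PiM_coordinates[OF Q]]) (use n in \<open>auto simp: lessThan_empty_iff\<close>)
  then interpret H: Hoeffding_ineq ?P "{..<n}" "\<lambda>i \<omega>. W (\<omega> i)" "\<lambda>_. 0" "\<lambda>_. C * p" "n * w"
    by unfold_locales (use W_bounds mean in auto)
  have meas[measurable]: "(\<lambda>\<omega>. \<omega> i) \<in> measurable ?P Q" if "i < n" for i
    using that by simp
  let ?D = "{\<omega> \<in> space ?P. \<bar>(\<Sum>i<n. W (\<omega> i)) - n * w\<bar> \<ge> n * (\<delta> / 2 * p)}"
  have sub: "{\<omega> \<in> space ?P. \<bar>sample_mean Z n \<omega> - p\<bar> > \<delta> * p}
      \<subseteq> (\<Union>i<n. {\<omega> \<in> space ?P. \<omega> i \<in> B}) \<union> ?D"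
  proof
    fix \<omega> assume "\<omega> \<in> {\<omega> \<in> space ?P. \<bar>sample_mean Z n \<omega> - p\<bar> > \<delta> * p}"
    then have sp: "\<omega> \<in> space ?P" and far: "\<bar>sample_mean Z n \<omega> - p\<bar> > \<delta> * p" by auto
    have "\<omega> \<in> ?D" if good: "\<forall>i<n. \<omega> i \<notin> B"
    proof -
      have "(\<Sum>i<n. Z (\<omega> i)) = (\<Sum>i<n. W (\<omega> i))"
        using sp good by (intro sum.cong) (auto simp: W_def space_PiM PiE_def Pi_def)
      then have "sample_mean Z n \<omega> - w = ((\<Sum>i<n. W (\<omega> i)) - n * w) / n"
        using n by (simp add: sample_mean_def field_simps)
      moreover have "\<bar>sample_mean Z n \<omega> - w\<bar> \<ge> \<delta> / 2 * p"
        using far bias unfolding w_def W_def by argo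
      ultimately have "\<delta> / 2 * p \<le> \<bar>(\<Sum>i<n. W (\<omega> i)) - n * w\<bar> / n"
        by simp
      then show ?thesis using n sp by (simp add: field_simps)
    qed
    then show "\<omega> \<in> (\<Union>i<n. {\<omega> \<in> space ?P. \<omega> i \<in> B}) \<union> ?D"
      using sp by blast
  qed
  have [measurable]: "(\<lambda>\<omega>. W (\<omega> i)) \<in> borel_measurable ?P" if "i < n" for i
    using that by measurable
  have [measurable]: "{\<omega> \<in> space ?P. \<omega> i \<in> B} \<in> sets ?P" if "i < n" for i
    using that by measurable
  have D_meas: "?D \<in> sets ?P"
    by measurable
  have "P.prob {\<omega> \<in> space ?P. \<bar>sample_mean Z n \<omega> - p\<bar> > \<delta> * p}
      \<le> P.prob ((\<Union>i<n. {\<omega> \<in> space ?P. \<omega> i \<in> B}) \<union> ?D)"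
    by (intro P.finite_measure_mono sub sets.Un D_meas sets.finite_UN) auto
  also have "\<dots> \<le> P.prob (\<Union>i<n. {\<omega> \<in> space ?P. \<omega> i \<in> B}) + P.prob ?D"
    by (intro measure_Un_le D_meas sets.finite_UN) auto
  also have "P.prob (\<Union>i<n. {\<omega> \<in> space ?P. \<omega> i \<in> B}) \<le> (\<Sum>i<n. P.prob {\<omega> \<in> space ?P. \<omega> i \<in> B})"
    by (intro measure_UNION_le) auto
  also have "\<dots> = n * Q.prob B"
    by (simp add: marginal_B)
  also have "P.prob ?D \<le> 2 * exp (- 2 * (n * (\<delta> / 2 * p))\<^sup>2 / (\<Sum>i<n. (C * p - 0)\<^sup>2))"
    by (rule H.Hoeffding_ineq_abs_ge) (use n \<delta> p C in auto)
  also have "- 2 * (n * (\<delta> / 2 * p))\<^sup>2 / (\<Sum>i<n. (C * p - 0)\<^sup>2) = - (real n * \<delta>\<^sup>2 / (2 * C\<^sup>2))"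
    using n p C by (simp add: field_simps power2_eq_square)
  finally show ?thesis by simp
qed

text \<open>
  The two error terms of the preceding concentration bound pull the number of replications in opposite
  directions: it must be small against the reciprocal of the bad set's probability and large against
  the square of the relative bound \<^term>\<open>R\<close>. If the former is exponentially large and \<^term>\<open>R\<close> is
  subexponential, there is room between them for a subexponential number of replications.
\<close>

lemma strongly_prob_efficientI:
  fixes Q :: "real \<Rightarrow> 'a measure" and Z :: "real \<Rightarrow> 'a \<Rightarrow> real" and p R :: "real \<Rightarrow> real"
  assumes Q: "\<forall>\<^sub>F \<gamma> in at_top. prob_space (Q \<gamma>)"
    and Z: "\<forall>\<^sub>F \<gamma> in at_top. Z \<gamma> \<in> borel_measurable (Q \<gamma>)"
    and B: "\<forall>\<^sub>F \<gamma> in at_top. B \<gamma> \<in> sets (Q \<gamma>)"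
    and p: "\<forall>\<^sub>F \<gamma> in at_top. 0 < p \<gamma>"
    and R: "\<forall>\<^sub>F \<gamma> in at_top. 0 < R \<gamma>"
    and bounded: "\<forall>\<^sub>F \<gamma> in at_top. \<forall>\<omega> \<in> space (Q \<gamma>) - B \<gamma>. 0 \<le> Z \<gamma> \<omega> \<and> Z \<gamma> \<omega> \<le> R \<gamma> * p \<gamma>"
    and bias: "\<And>\<delta>. 0 < \<delta> \<Longrightarrow> \<forall>\<^sub>F \<gamma> in at_top.
        \<bar>(\<integral>\<omega>. indicator (space (Q \<gamma>) - B \<gamma>) \<omega> * Z \<gamma> \<omega> \<partial>Q \<gamma>) - p \<gamma>\<bar> \<le> \<delta> * p \<gamma>"
    and bad: "exp_decaying (\<lambda>\<gamma>. measure (Q \<gamma>) (B \<gamma>))"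
    and R_subexp: "\<And>\<eta>. 0 < \<eta> \<Longrightarrow> \<forall>\<^sub>F \<gamma> in at_top. R \<gamma> \<le> exp (\<eta> * \<gamma>)"
    and p_decay: "exp_decaying p"
  shows "strongly_prob_efficient Q Z p"
proof -
  \<comment> \<open>The factor \<^term>\<open>\<gamma>\<close> makes the Hoeffding term vanish, because the exponent is of order \<^term>\<open>n \<gamma> / (R \<gamma>)\<^sup>2\<close>.\<close>
  define n where "n \<gamma> = nat \<lceil>max 1 (\<gamma> * (R \<gamma>)\<^sup>2)\<rceil>" for \<gamma>
  have n_ge1: "1 \<le> n \<gamma>" for \<gamma>
  proof -
    have "real (n \<gamma>) \<ge> max 1 (\<gamma> * (R \<gamma>)\<^sup>2)"
      unfolding n_def by (rule real_nat_ceiling_ge)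
    then show ?thesis by linarith
  qed
  have n_ge: "\<gamma> * (R \<gamma>)\<^sup>2 \<le> n \<gamma>" for \<gamma>
    unfolding n_def using real_nat_ceiling_ge[of "max 1 (\<gamma> * (R \<gamma>)\<^sup>2)"] by linarith
  have n_subexp: "\<forall>\<^sub>F \<gamma> in at_top. real (n \<gamma>) \<le> exp (\<eta> * \<gamma>)" if \<eta>: "0 < \<eta>" for \<eta>
  proof -
    have "\<forall>\<^sub>F \<gamma> in at_top. 2 + \<gamma> * exp (\<eta> / 2 * \<gamma>) \<le> exp (\<eta> * \<gamma>)"
      using \<eta> by real_asymp
    moreover have "\<forall>\<^sub>F \<gamma> in at_top. R \<gamma> \<le> exp (\<eta> / 4 * \<gamma>)"
      using \<eta> by (intro R_subexp) auto
    ultimately show ?thesis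
      using R eventually_gt_at_top[of 0]
    proof eventually_elim
      case (elim \<gamma>)
      have "(R \<gamma>)\<^sup>2 \<le> (exp (\<eta> / 4 * \<gamma>))\<^sup>2"
        using elim by (intro power_mono) auto
      also have "\<dots> = exp (\<eta> / 2 * \<gamma>)"
        by (simp flip: exp_double)
      finally have "\<gamma> * (R \<gamma>)\<^sup>2 \<le> \<gamma> * exp (\<eta> / 2 * \<gamma>)"
        using elim by (intro mult_left_mono) auto
      moreover have "real (n \<gamma>) \<le> 1 + max 1 (\<gamma> * (R \<gamma>)\<^sup>2)"
        unfolding n_def by linarith
      moreover have "0 \<le> \<gamma> * (R \<gamma>)\<^sup>2" using elim by auto
      ultimately show ?case using elim by linarith
    qed
  qed
  obtain \<theta> where \<theta>: "\<theta> > 0" "\<forall>\<^sub>F \<gamma> in at_top. p \<gamma> \<le> exp (- \<theta> * \<gamma>)"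
    using p_decay by (auto simp: exp_decaying_def)
  have size: "((\<lambda>\<gamma>. ln (real (n \<gamma>)) / (- ln (p \<gamma>))) \<longlongrightarrow> 0) at_top"
  proof (rule tendstoI)
    fix e :: real assume e: "0 < e"
    have "\<forall>\<^sub>F \<gamma> in at_top. real (n \<gamma>) \<le> exp ((e * \<theta> / 2) * \<gamma>)"
      using e \<theta> by (intro n_subexp) auto
    then show "\<forall>\<^sub>F \<gamma> in at_top. dist (ln (real (n \<gamma>)) / (- ln (p \<gamma>))) 0 < e"
      using \<theta>(2) p eventually_gt_at_top[of 0]
    proof eventually_elim
      case (elim \<gamma>)
      have "ln (real (n \<gamma>)) \<le> ln (exp (e * \<theta> / 2 * \<gamma>))"
        using elim n_ge1[of \<gamma>] by (subst ln_le_cancel_iff) auto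
      then have 1: "ln (real (n \<gamma>)) \<le> e * (\<theta> * \<gamma>) / 2" by simp
      have "ln (p \<gamma>) \<le> ln (exp (- \<theta> * \<gamma>))"
        using elim by (subst ln_le_cancel_iff) auto
      then have 2: "\<theta> * \<gamma> \<le> - ln (p \<gamma>)" by simp
      have 3: "0 < \<theta> * \<gamma>" using elim \<theta> by simp
      have 4: "0 \<le> ln (real (n \<gamma>))" using n_ge1[of \<gamma>] by simp
      have "e * (\<theta> * \<gamma>) / 2 < e * (- ln (p \<gamma>))"
      proof -
        have "e * (\<theta> * \<gamma>) \<le> e * (- ln (p \<gamma>))"
          using 2 e by (intro mult_left_mono) auto
        moreover have "e * (\<theta> * \<gamma>) > 0" using e 3 by simp
        ultimately show ?thesis by linarith
      qed
      then have "ln (real (n \<gamma>)) / (- ln (p \<gamma>)) < e"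
        using 1 2 3 by (subst pos_divide_less_eq) auto
      moreover have "0 \<le> ln (real (n \<gamma>)) / (- ln (p \<gamma>))"
        using 2 3 4 by (intro divide_nonneg_pos) linarith+
      ultimately show ?case unfolding dist_real_def by linarith
    qed
  qed
  obtain \<kappa> where \<kappa>: "\<kappa> > 0" "\<forall>\<^sub>F \<gamma> in at_top. measure (Q \<gamma>) (B \<gamma>) \<le> exp (- \<kappa> * \<gamma>)"
    using bad by (auto simp: exp_decaying_def)
  have error: "((\<lambda>\<gamma>. rel_error (Q \<gamma>) (Z \<gamma>) (n \<gamma>) (p \<gamma>) \<epsilon>) \<longlongrightarrow> 0) at_top"
    if \<epsilon>: "0 < \<epsilon>" for \<epsilon>
  proof -
    have small: "\<forall>\<^sub>F \<gamma> in at_top. rel_error (Q \<gamma>) (Z \<gamma>) (n \<gamma>) (p \<gamma>) \<epsilon> \<le> ereal \<delta>" if \<delta>: "0 < \<delta>" for \<delta>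
    proof -
      have "\<forall>\<^sub>F \<gamma> in at_top. exp (\<kappa> / 2 * \<gamma>) * exp (- \<kappa> * \<gamma>) + 2 * exp (- \<gamma> * \<delta>\<^sup>2 / 2) \<le> \<epsilon>"
      proof -
        have "((\<lambda>\<gamma>. exp (\<kappa> / 2 * \<gamma>) * exp (- \<kappa> * \<gamma>) + 2 * exp (- \<gamma> * \<delta>\<^sup>2 / 2)) \<longlongrightarrow> 0) at_top"
        proof -
          have "((\<lambda>\<gamma>. exp (\<kappa> / 2 * \<gamma>) * exp (- \<kappa> * \<gamma>)) \<longlongrightarrow> 0) at_top"
            using \<kappa>(1) by real_asymp
          moreover have "((\<lambda>\<gamma>. 2 * exp (- \<gamma> * \<delta>\<^sup>2 / 2)) \<longlongrightarrow> 0) at_top"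
            using \<delta> by real_asymp
          ultimately show ?thesis by (rule tendsto_add_zero)
        qed
        from order_tendstoD(2)[OF this \<epsilon>] show ?thesis
          by eventually_elim simp
      qed
      moreover have "\<forall>\<^sub>F \<gamma> in at_top. real (n \<gamma>) \<le> exp (\<kappa> / 2 * \<gamma>)"
        using \<kappa> by (intro n_subexp) auto
      moreover have "\<forall>\<^sub>F \<gamma> in at_top.
          \<bar>(\<integral>\<omega>. indicator (space (Q \<gamma>) - B \<gamma>) \<omega> * Z \<gamma> \<omega> \<partial>Q \<gamma>) - p \<gamma>\<bar> \<le> \<delta> / 2 * p \<gamma>"
        using \<delta> by (intro bias) auto
      ultimately show ?thesis
        using Q Z B p R bounded \<kappa>(2)
      proof eventually_elim
        case (elim \<gamma>)
        have "measure (\<Pi>\<^sub>M i\<in>{..<n \<gamma>}. Q \<gamma>)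
           {\<omega> \<in> space (\<Pi>\<^sub>M i\<in>{..<n \<gamma>}. Q \<gamma>). \<bar>sample_mean (Z \<gamma>) (n \<gamma>) \<omega> - p \<gamma>\<bar> > \<delta> * p \<gamma>}
           \<le> n \<gamma> * measure (Q \<gamma>) (B \<gamma>) + 2 * exp (- (real (n \<gamma>) * \<delta>\<^sup>2 / (2 * (R \<gamma>)\<^sup>2)))"
          by (rule sample_mean_error) (use elim n_ge1[of \<gamma>] \<delta> in \<open>blast+\<close>)
        also have "n \<gamma> * measure (Q \<gamma>) (B \<gamma>) \<le> exp (\<kappa> / 2 * \<gamma>) * exp (- \<kappa> * \<gamma>)"
          using elim by (intro mult_mono) auto
        also have "exp (- (real (n \<gamma>) * \<delta>\<^sup>2 / (2 * (R \<gamma>)\<^sup>2))) \<le> exp (- \<gamma> * \<delta>\<^sup>2 / 2)"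
        proof -
          have "\<gamma> * (R \<gamma>)\<^sup>2 * \<delta>\<^sup>2 \<le> n \<gamma> * \<delta>\<^sup>2"
            using n_ge[of \<gamma>] by (intro mult_right_mono) auto
          then show ?thesis using elim by (simp add: field_simps)
        qed
        finally have "measure (\<Pi>\<^sub>M i\<in>{..<n \<gamma>}. Q \<gamma>)
           {\<omega> \<in> space (\<Pi>\<^sub>M i\<in>{..<n \<gamma>}. Q \<gamma>). \<bar>sample_mean (Z \<gamma>) (n \<gamma>) \<omega> - p \<gamma>\<bar> > \<delta> * p \<gamma>} \<le> \<epsilon>"
          using elim by simp
        then show ?case
          unfolding rel_error_def using \<delta> by (intro Inf_lower imageI) simp
      qed
    qed
    have nonneg: "0 \<le> rel_error (Q \<gamma>) (Z \<gamma>) (n \<gamma>) (p \<gamma>) \<epsilon>" for \<gamma>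
      unfolding rel_error_def by (rule Inf_greatest) auto
    show ?thesis
    proof (rule order_tendstoI)
      fix u :: ereal assume "u < 0"
      then show "\<forall>\<^sub>F \<gamma> in at_top. u < rel_error (Q \<gamma>) (Z \<gamma>) (n \<gamma>) (p \<gamma>) \<epsilon>"
        using nonneg by (intro always_eventually allI) (rule less_le_trans)
    next
      fix u :: ereal assume "0 < u"
      then obtain \<delta> where "0 < ereal \<delta>" "ereal \<delta> < u"
        using ereal_dense2 by blast
      then show "\<forall>\<^sub>F \<gamma> in at_top. rel_error (Q \<gamma>) (Z \<gamma>) (n \<gamma>) (p \<gamma>) \<epsilon> < u"
        using eventually_mono[OF small[of \<delta>]] by (simp add: le_less_trans)
    qed
  qed
  show ?thesis
    unfolding strongly_prob_efficient_def using n_ge1 size error by blast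
qed

section \<open>Cumulant generating functions and tilted measures\<close>

lemma nn_integral_exp_shift:
  fixes Y :: "'a \<Rightarrow> 'v::euclidean_space"
  assumes [measurable]: "Y \<in> borel_measurable M"
  shows "(\<integral>\<^sup>+ \<omega>. ennreal (exp (x \<bullet> Y \<omega> - c)) \<partial>M)
    = (\<integral>\<^sup>+ \<omega>. ennreal (exp (x \<bullet> Y \<omega>)) \<partial>M) * ennreal (exp (- c))"
proof -
  have "(\<integral>\<^sup>+ \<omega>. ennreal (exp (x \<bullet> Y \<omega> - c)) \<partial>M)
      = (\<integral>\<^sup>+ \<omega>. ennreal (exp (x \<bullet> Y \<omega>)) * ennreal (exp (- c)) \<partial>M)"
    by (intro nn_integral_cong) (simp flip: ennreal_mult exp_add)
  also have "\<dots> = (\<integral>\<^sup>+ \<omega>. ennreal (exp (x \<bullet> Y \<omega>)) \<partial>M) * ennreal (exp (- c))"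
    by (intro nn_integral_multc) measurable
  finally show ?thesis .
qed

text \<open>
  Normalising the moment generating function turns bounds on the cumulant generating function into
  bounds on an integral by 1, in which its infinite values need no separate treatment.
\<close>

lemma scaled_cgf_le_iff:
  fixes X :: "real \<Rightarrow> 'a \<Rightarrow> 'v::euclidean_space"
  assumes \<gamma>: "0 < \<gamma>" and X: "X \<gamma> \<in> borel_measurable M"
  shows "scaled_cgf M X \<gamma> x \<le> ereal \<alpha> \<longleftrightarrow>
     (\<integral>\<^sup>+ \<omega>. ennreal (exp (x \<bullet> X \<gamma> \<omega> - \<gamma> * \<alpha>)) \<partial>M) \<le> 1"
proof -
  define L where "L = (\<integral>\<^sup>+ \<omega>. ennreal (exp (x \<bullet> X \<gamma> \<omega>)) \<partial>M)"
  have eq: "(\<integral>\<^sup>+ \<omega>. ennreal (exp (x \<bullet> X \<gamma> \<omega> - \<gamma> * \<alpha>)) \<partial>M) = L * ennreal (exp (- \<gamma> * \<alpha>))"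
    by (simp add: L_def nn_integral_exp_shift[OF X])
  have cgf: "scaled_cgf M X \<gamma> x = ereal (1 / \<gamma>) * ln_ennreal L"
    by (simp add: scaled_cgf_def L_def)
  show ?thesis
  proof (cases L)
    case top
    then show ?thesis using \<gamma> unfolding eq cgf
      by (simp add: ln_ennreal_def ennreal_top_mult top_unique)
  next
    case (real v)
    show ?thesis
    proof (cases "v = 0")
      case True
      then show ?thesis using \<gamma> real unfolding eq cgf by (simp add: ln_ennreal_def)
    next
      case False
      then have v: "0 < v" using real by simp
      have "scaled_cgf M X \<gamma> x \<le> ereal \<alpha> \<longleftrightarrow> ln v \<le> \<gamma> * \<alpha>"
        using \<gamma> v real unfolding cgf by (simp add: ln_ennreal_def field_simps)
      also have "\<dots> \<longleftrightarrow> v \<le> exp (\<gamma> * \<alpha>)"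
        using v by (metis exp_le_cancel_iff exp_ln)
      also have "\<dots> \<longleftrightarrow> v * exp (- \<gamma> * \<alpha>) \<le> 1"
        by (simp add: exp_minus field_simps)
      also have "\<dots> \<longleftrightarrow> L * ennreal (exp (- \<gamma> * \<alpha>)) \<le> 1"
        using v real by (simp flip: ennreal_mult ennreal_1)
      finally show ?thesis unfolding eq .
    qed
  qed
qed

lemma scaled_cgf_eq_imp:
  fixes X :: "real \<Rightarrow> 'a \<Rightarrow> 'v::euclidean_space"
  assumes \<gamma>: "0 < \<gamma>" and X: "X \<gamma> \<in> borel_measurable M"
    and eq: "scaled_cgf M X \<gamma> x = ereal m"
  shows "(\<integral>\<^sup>+ \<omega>. ennreal (exp (x \<bullet> X \<gamma> \<omega> - \<gamma> * m)) \<partial>M) = 1"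
proof -
  define L where "L = (\<integral>\<^sup>+ \<omega>. ennreal (exp (x \<bullet> X \<gamma> \<omega>)) \<partial>M)"
  have cgf: "ereal (1 / \<gamma>) * ln_ennreal L = ereal m"
    using eq by (simp add: scaled_cgf_def L_def)
  obtain v where v: "0 < v" "L = ennreal v"
  proof (cases L)
    case top
    then show ?thesis using cgf \<gamma> by (simp add: ln_ennreal_def)
  next
    case (real v)
    then show ?thesis using cgf \<gamma> that[of v] by (cases "v = 0") (auto simp: ln_ennreal_def)
  qed
  then have "ln v = \<gamma> * m" using cgf \<gamma> by (simp add: ln_ennreal_def field_simps)
  then have L: "L = ennreal (exp (\<gamma> * m))" using v by (metis exp_ln)
  have "(\<integral>\<^sup>+ \<omega>. ennreal (exp (x \<bullet> X \<gamma> \<omega> - \<gamma> * m)) \<partial>M) = L * ennreal (exp (- \<gamma> * m))"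
    by (simp add: L_def nn_integral_exp_shift[OF X])
  also have "\<dots> = 1"
    by (simp add: L flip: ennreal_mult exp_add)
  finally show ?thesis .
qed

locale scaled_cgf_limit = prob_space M
  for M :: "'a measure" and X :: "real \<Rightarrow> 'a \<Rightarrow> 'v::euclidean_space" and \<mu> :: "'v \<Rightarrow> ereal" +
  assumes X_measurable: "0 < \<gamma> \<Longrightarrow> X \<gamma> \<in> borel_measurable M"
    and scaled_cgf_tendsto: "((\<lambda>\<gamma>. scaled_cgf M X \<gamma> x) \<longlongrightarrow> \<mu> x) at_top"
begin

text \<open>
  After normalisation Hoelder's inequality reduces to the pointwise convexity of the exponential
  function.
\<close>

lemma scaled_cgf_convex:
  assumes \<gamma>: "0 < \<gamma>" and x: "scaled_cgf M X \<gamma> x \<le> ereal \<alpha>" and y: "scaled_cgf M X \<gamma> y \<le> ereal \<beta>"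
    and t: "0 \<le> t" "t \<le> 1"
  shows "scaled_cgf M X \<gamma> ((1 - t) *\<^sub>R x + t *\<^sub>R y) \<le> ereal ((1 - t) * \<alpha> + t * \<beta>)"
proof -
  note X_measurable[OF \<gamma>, measurable]
  let ?f = "\<lambda>\<omega>. x \<bullet> X \<gamma> \<omega> - \<gamma> * \<alpha>" and ?g = "\<lambda>\<omega>. y \<bullet> X \<gamma> \<omega> - \<gamma> * \<beta>"
  have "(\<integral>\<^sup>+ \<omega>. ennreal (exp (((1 - t) *\<^sub>R x + t *\<^sub>R y) \<bullet> X \<gamma> \<omega> - \<gamma> * ((1 - t) * \<alpha> + t * \<beta>))) \<partial>M)
      = (\<integral>\<^sup>+ \<omega>. ennreal (exp ((1 - t) * ?f \<omega> + t * ?g \<omega>)) \<partial>M)"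
    by (intro nn_integral_cong arg_cong[where f = "\<lambda>z. ennreal (exp z)"])
       (simp add: algebra_simps inner_add_left inner_diff_left)
  also have "\<dots> \<le> (\<integral>\<^sup>+ \<omega>. ennreal (1 - t) * ennreal (exp (?f \<omega>)) + ennreal t * ennreal (exp (?g \<omega>)) \<partial>M)"
  proof (intro nn_integral_mono)
    fix \<omega>
    have "exp ((1 - t) * ?f \<omega> + t * ?g \<omega>) \<le> (1 - t) * exp (?f \<omega>) + t * exp (?g \<omega>)"
      using convex_onD[OF exp_convex, of t "?f \<omega>" "?g \<omega>"] t by simp
    then show "ennreal (exp ((1 - t) * ?f \<omega> + t * ?g \<omega>))
        \<le> ennreal (1 - t) * ennreal (exp (?f \<omega>)) + ennreal t * ennreal (exp (?g \<omega>))"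
      using t by (simp flip: ennreal_mult ennreal_plus)
  qed
  also have "\<dots> = ennreal (1 - t) * (\<integral>\<^sup>+ \<omega>. ennreal (exp (?f \<omega>)) \<partial>M) + ennreal t * (\<integral>\<^sup>+ \<omega>. ennreal (exp (?g \<omega>)) \<partial>M)"
    by (simp add: nn_integral_add nn_integral_cmult)
  also have "\<dots> \<le> ennreal (1 - t) * 1 + ennreal t * 1"
    using x y \<gamma> X_measurable[OF \<gamma>] by (intro add_mono mult_left_mono) (simp_all add: scaled_cgf_le_iff)
  also have "\<dots> = 1" using t by (simp flip: ennreal_plus)
  finally show ?thesis
    using \<gamma> X_measurable[OF \<gamma>] by (simp add: scaled_cgf_le_iff)
qed

lemma eventually_scaled_cgf_le:
  "\<mu> x < ereal \<alpha> \<Longrightarrow> \<forall>\<^sub>F \<gamma> in at_top. scaled_cgf M X \<gamma> x \<le> ereal \<alpha>"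
  using order_tendstoD(2)[OF scaled_cgf_tendsto] by (rule eventually_mono) auto

lemma epi_convex_limit: "epi_convex \<mu>"
  unfolding epi_convex_def
proof (intro allI impI)
  fix x y :: 'v and \<alpha> \<beta> t :: real
  assume x: "\<mu> x \<le> ereal \<alpha>" and y: "\<mu> y \<le> ereal \<beta>" and t: "0 \<le> t" "t \<le> 1"
  show "\<mu> ((1 - t) *\<^sub>R x + t *\<^sub>R y) \<le> ereal ((1 - t) * \<alpha> + t * \<beta>)"
  proof (rule ereal_le_epsilon2)
    fix e :: real assume e: "0 < e"
    have 1: "\<forall>\<^sub>F \<gamma> in at_top. scaled_cgf M X \<gamma> x \<le> ereal (\<alpha> + e)"
      using x e by (intro eventually_scaled_cgf_le) (simp add: le_less_trans)
    have 2: "\<forall>\<^sub>F \<gamma> in at_top. scaled_cgf M X \<gamma> y \<le> ereal (\<beta> + e)"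
      using y e by (intro eventually_scaled_cgf_le) (simp add: le_less_trans)
    have "\<mu> ((1 - t) *\<^sub>R x + t *\<^sub>R y) \<le> ereal ((1 - t) * (\<alpha> + e) + t * (\<beta> + e))"
    proof (rule tendsto_upperbound[OF scaled_cgf_tendsto])
      show "\<forall>\<^sub>F \<gamma> in at_top. scaled_cgf M X \<gamma> ((1 - t) *\<^sub>R x + t *\<^sub>R y)
          \<le> ereal ((1 - t) * (\<alpha> + e) + t * (\<beta> + e))"
        using 1 2 eventually_gt_at_top[of 0]
        by eventually_elim (rule scaled_cgf_convex, use t in auto)
    qed simp
    also have "(1 - t) * (\<alpha> + e) + t * (\<beta> + e) = (1 - t) * \<alpha> + t * \<beta> + e"
      by (simp add: algebra_simps)
    finally show "\<mu> ((1 - t) *\<^sub>R x + t *\<^sub>R y) \<le> ereal ((1 - t) * \<alpha> + t * \<beta>) + ereal e"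
      by simp
  qed
qed

lemma scaled_cgf_at_gradient:
  assumes "has_gradient \<mu> s y"
  shows eventually_scaled_cgf_finite: "\<forall>\<^sub>F \<gamma> in at_top. scaled_cgf M X \<gamma> s = ereal (real_of_ereal (scaled_cgf M X \<gamma> s))"
    and real_scaled_cgf_tendsto: "((\<lambda>\<gamma>. real_of_ereal (scaled_cgf M X \<gamma> s)) \<longlongrightarrow> real_of_ereal (\<mu> s)) at_top"
proof -
  have lim: "((\<lambda>\<gamma>. scaled_cgf M X \<gamma> s) \<longlongrightarrow> ereal (real_of_ereal (\<mu> s))) at_top"
    using scaled_cgf_tendsto[of s] has_gradient_finite[OF assms] by simp
  then show "((\<lambda>\<gamma>. real_of_ereal (scaled_cgf M X \<gamma> s)) \<longlongrightarrow> real_of_ereal (\<mu> s)) at_top"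
    by (rule lim_real_of_ereal)
  have "\<forall>\<^sub>F \<gamma> in at_top. scaled_cgf M X \<gamma> s < \<infinity>" "\<forall>\<^sub>F \<gamma> in at_top. - \<infinity> < scaled_cgf M X \<gamma> s"
    by (rule order_tendstoD(2)[OF lim] order_tendstoD(1)[OF lim]; simp)+
  then show "\<forall>\<^sub>F \<gamma> in at_top. scaled_cgf M X \<gamma> s = ereal (real_of_ereal (scaled_cgf M X \<gamma> s))"
    by eventually_elim (metis ereal_infty_less(1,2) ereal_real' abs_ereal.simps less_irrefl abs_eq_infinity_cases)
qed

lemma sets_tilted_measure [measurable_cong]: "sets (tilted_measure M X s \<gamma>) = sets M"
  by (simp add: tilted_measure_def)

lemma space_tilted_measure [simp]: "space (tilted_measure M X s \<gamma>) = space M"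
  by (simp add: tilted_measure_def)

lemma prob_space_tilted_measure:
  assumes \<gamma>: "0 < \<gamma>" and fin: "scaled_cgf M X \<gamma> s = ereal (real_of_ereal (scaled_cgf M X \<gamma> s))"
  shows "prob_space (tilted_measure M X s \<gamma>)"
proof
  note X_measurable[OF \<gamma>, measurable]
  show "emeasure (tilted_measure M X s \<gamma>) (space (tilted_measure M X s \<gamma>)) = 1"
    unfolding space_tilted_measure unfolding tilted_measure_def
    using scaled_cgf_eq_imp[OF \<gamma> X_measurable[OF \<gamma>] fin]
    by (subst emeasure_density) (auto simp: nn_integral_set_ennreal cong: nn_integral_cong)
qed

lemma tilted_measure_0: "tilted_measure M X 0 \<gamma> = M"
  by (simp add: tilted_measure_def scaled_cgf_def ln_ennreal_def emeasure_space_1 density_1)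

text \<open>
  Chernoff's bound under the tilted measure. Tilting by \<^term>\<open>s\<close> and then bounding the indicator of a
  half-space by an exponential in direction \<^term>\<open>u\<close> amounts to evaluating the cumulant generating
  function at a shifted argument. With \<open>s = 0\<close> this bounds the original probabilities.
\<close>

lemma tilted_tail_bound:
  assumes \<gamma>: "0 < \<gamma>" and t: "0 \<le> t" and \<beta>: "scaled_cgf M X \<gamma> (s + t *\<^sub>R u) \<le> ereal \<beta>"
  shows "measure (tilted_measure M X s \<gamma>) {\<omega> \<in> space M. c \<le> u \<bullet> ((1 / \<gamma>) *\<^sub>R X \<gamma> \<omega>)}
    \<le> exp (\<gamma> * (\<beta> - real_of_ereal (scaled_cgf M X \<gamma> s) - t * c))"
proof -
  note X_measurable[OF \<gamma>, measurable]
  let ?m = "real_of_ereal (scaled_cgf M X \<gamma> s)"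
  let ?S = "{\<omega> \<in> space M. c \<le> u \<bullet> ((1 / \<gamma>) *\<^sub>R X \<gamma> \<omega>)}"
  have S: "?S \<in> sets M" by measurable
  have "emeasure (tilted_measure M X s \<gamma>) ?S
      = (\<integral>\<^sup>+ \<omega>. ennreal (exp (s \<bullet> X \<gamma> \<omega> - \<gamma> * ?m)) * indicator ?S \<omega> \<partial>M)"
    unfolding tilted_measure_def by (rule emeasure_density) (use S in \<open>measurable\<close>)
  also have "\<dots> \<le> (\<integral>\<^sup>+ \<omega>. ennreal (exp (\<gamma> * (\<beta> - ?m - t * c))) *
      ennreal (exp ((s + t *\<^sub>R u) \<bullet> X \<gamma> \<omega> - \<gamma> * \<beta>)) \<partial>M)"
  proof (intro nn_integral_mono)
    fix \<omega>
    show "ennreal (exp (s \<bullet> X \<gamma> \<omega> - \<gamma> * ?m)) * indicator ?S \<omega> \<le> ennreal (exp (\<gamma> * (\<beta> - ?m - t * c))) *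
      ennreal (exp ((s + t *\<^sub>R u) \<bullet> X \<gamma> \<omega> - \<gamma> * \<beta>))"
    proof (cases "\<omega> \<in> ?S")
      case True
      then have "\<gamma> * c \<le> u \<bullet> X \<gamma> \<omega>" using \<gamma> by (simp add: field_simps)
      then have "t * (\<gamma> * c) \<le> t * (u \<bullet> X \<gamma> \<omega>)" using t by (rule mult_left_mono)
      then have "s \<bullet> X \<gamma> \<omega> - \<gamma> * ?m \<le> \<gamma> * (\<beta> - ?m - t * c) + ((s + t *\<^sub>R u) \<bullet> X \<gamma> \<omega> - \<gamma> * \<beta>)"
        by (simp add: algebra_simps inner_add_left)
      then have "exp (s \<bullet> X \<gamma> \<omega> - \<gamma> * ?m) \<le> exp (\<gamma> * (\<beta> - ?m - t * c)) * exp ((s + t *\<^sub>R u) \<bullet> X \<gamma> \<omega> - \<gamma> * \<beta>)"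
        by (simp flip: exp_add)
      then show ?thesis using True by (simp add: ennreal_leI flip: ennreal_mult)
    qed simp
  qed
  also have "\<dots> = ennreal (exp (\<gamma> * (\<beta> - ?m - t * c))) *
      (\<integral>\<^sup>+ \<omega>. ennreal (exp ((s + t *\<^sub>R u) \<bullet> X \<gamma> \<omega> - \<gamma> * \<beta>)) \<partial>M)"
    by (intro nn_integral_cmult) measurable
  also have "\<dots> \<le> ennreal (exp (\<gamma> * (\<beta> - ?m - t * c))) * 1"
    using \<beta> \<gamma> X_measurable[OF \<gamma>] by (intro mult_left_mono) (simp_all add: scaled_cgf_le_iff)
  finally show ?thesis
    unfolding measure_def by (intro enn2real_leI) auto
qed

text \<open>
  Chernoff's bound in the direction \<^term>\<open>s\<close> has exponent \<open>s \<bullet> b\<close> minus the cumulant generating function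
  at \<^term>\<open>s\<close>, which converges to the rate at \<^term>\<open>b\<close>, because \<^term>\<open>b\<close> is the gradient at \<^term>\<open>s\<close>.
\<close>

lemma half_space_prob:
  assumes grad: "has_gradient \<mu> s b" and \<theta>: "\<theta> < s \<bullet> b - real_of_ereal (\<mu> s)"
  shows "\<forall>\<^sub>F \<gamma> in at_top. measure M {\<omega> \<in> space M. s \<bullet> b \<le> s \<bullet> ((1 / \<gamma>) *\<^sub>R X \<gamma> \<omega>)} \<le> exp (- \<theta> * \<gamma>)"
proof -
  have "\<mu> s < ereal (s \<bullet> b - \<theta>)"
    by (subst has_gradient_finite[OF grad]) (use \<theta> in simp)
  from eventually_scaled_cgf_le[OF this] eventually_gt_at_top[of 0] show ?thesis
  proof eventually_elim
    case (elim \<gamma>)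
    have zero: "scaled_cgf M X \<gamma> 0 = 0"
      by (simp add: scaled_cgf_def ln_ennreal_def emeasure_space_1)
    show ?case
      using tilted_tail_bound[of \<gamma> 1 0 s "s \<bullet> b - \<theta>" "s \<bullet> b"] elim
      by (simp add: tilted_measure_0 zero mult.commute)
  qed
qed

text \<open>
  The tilted measure concentrates at the gradient \<^term>\<open>y\<close>: the exponent in Chernoff's bound is the
  increment of \<^term>\<open>\<mu>\<close> in direction \<^term>\<open>u\<close> minus \<^term>\<open>t * c\<close>, to first order \<open>t * (u \<bullet> y - c)\<close>, and
  hence negative for small \<^term>\<open>t\<close>.
\<close>

lemma tilted_tail_decay:
  assumes grad: "has_gradient \<mu> s y" and c: "u \<bullet> y < c"
  shows "exp_decaying (\<lambda>\<gamma>. measure (tilted_measure M X s \<gamma>) {\<omega> \<in> space M. c \<le> u \<bullet> ((1 / \<gamma>) *\<^sub>R X \<gamma> \<omega>)})"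
proof -
  let ?m = "real_of_ereal (\<mu> s)"
  obtain t where t: "0 < t" "\<mu> (s + t *\<^sub>R u) < ereal (?m + t * c)"
    using eventually_happens[OF eventually_conj[OF eventually_at_right_less[of 0] gradient_less[OF grad c]]]
    by (auto simp: trivial_limit_at_right_real)
  obtain \<beta> where \<beta>: "\<mu> (s + t *\<^sub>R u) < ereal \<beta>" "\<beta> < ?m + t * c"
    using ereal_dense2[OF t(2)] by auto
  define \<kappa> where "\<kappa> = (?m + t * c - \<beta>) / 2"
  have \<kappa>: "0 < \<kappa>" using \<beta> by (simp add: \<kappa>_def)
  have "\<forall>\<^sub>F \<gamma> in at_top. ?m - \<kappa> < real_of_ereal (scaled_cgf M X \<gamma> s)"
    using \<kappa> by (intro order_tendstoD(1)[OF real_scaled_cgf_tendsto[OF grad]]) simp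
  with eventually_scaled_cgf_le[OF \<beta>(1)]
  have "\<forall>\<^sub>F \<gamma> in at_top. measure (tilted_measure M X s \<gamma>) {\<omega> \<in> space M. c \<le> u \<bullet> ((1 / \<gamma>) *\<^sub>R X \<gamma> \<omega>)}
      \<le> exp (- \<kappa> * \<gamma>)"
    using eventually_gt_at_top[of 0]
  proof eventually_elim
    case (elim \<gamma>)
    have "measure (tilted_measure M X s \<gamma>) {\<omega> \<in> space M. c \<le> u \<bullet> ((1 / \<gamma>) *\<^sub>R X \<gamma> \<omega>)}
      \<le> exp (\<gamma> * (\<beta> - real_of_ereal (scaled_cgf M X \<gamma> s) - t * c))"
      using elim t by (intro tilted_tail_bound) auto
    also have "\<dots> \<le> exp (\<gamma> * (- \<kappa>))"
    proof -
      have "\<beta> - real_of_ereal (scaled_cgf M X \<gamma> s) - t * c \<le> - \<kappa>"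
        using elim by (simp add: \<kappa>_def field_simps)
      then show ?thesis using elim by (subst exp_le_cancel_iff) (intro mult_left_mono, auto)
    qed
    finally show ?case by (simp add: mult.commute)
  qed
  then show ?thesis using \<kappa> by (auto simp: exp_decaying_def)
qed

section \<open>The large deviation lower bound\<close>

lemma eventually_prob_space_tilted:
  assumes "has_gradient \<mu> s y"
  shows "\<forall>\<^sub>F \<gamma> in at_top. prob_space (tilted_measure M X s \<gamma>)"
  using eventually_scaled_cgf_finite[OF assms] eventually_gt_at_top[of 0]
  by eventually_elim (rule prob_space_tilted_measure)

text \<open>
  Leaving a ball around \<^term>\<open>y\<close> means leaving a box contained in it, that is, entering one of finitely many
  half-spaces that do not contain \<^term>\<open>y\<close>.
\<close>

lemma tilted_concentration:
  assumes grad: "has_gradient \<mu> s y" and \<delta>: "0 < \<delta>"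
  shows "exp_decaying (\<lambda>\<gamma>. measure (tilted_measure M X s \<gamma>)
    {\<omega> \<in> space M. \<delta> \<le> norm ((1 / \<gamma>) *\<^sub>R X \<gamma> \<omega> - y)})"
proof -
  define d where "d = \<delta> / (2 * DIM('v))"
  have d: "0 < d" using \<delta> by (simp add: d_def)
  define H where "H \<gamma> u = {\<omega> \<in> space M. u \<bullet> y + d \<le> u \<bullet> ((1 / \<gamma>) *\<^sub>R X \<gamma> \<omega>)}" for \<gamma> u
  let ?U = "Basis \<union> uminus ` Basis :: 'v set"
  have "exp_decaying (\<lambda>\<gamma>. \<Sum>u\<in>?U. measure (tilted_measure M X s \<gamma>) (H \<gamma> u))"
    unfolding H_def using d by (intro exp_decaying_sum tilted_tail_decay[OF grad]) auto
  moreover have "\<forall>\<^sub>F \<gamma> in at_top. measure (tilted_measure M X s \<gamma>)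
      {\<omega> \<in> space M. \<delta> \<le> norm ((1 / \<gamma>) *\<^sub>R X \<gamma> \<omega> - y)}
      \<le> (\<Sum>u\<in>?U. measure (tilted_measure M X s \<gamma>) (H \<gamma> u))"
    using eventually_prob_space_tilted[OF grad] eventually_gt_at_top[of 0]
  proof eventually_elim
    case (elim \<gamma>)
    interpret Q: prob_space "tilted_measure M X s \<gamma>" by (rule elim)
    note X_measurable[OF elim(2), measurable]
    have H: "H \<gamma> u \<in> sets (tilted_measure M X s \<gamma>)" for u
      unfolding H_def sets_tilted_measure by measurable
    have "{\<omega> \<in> space M. \<delta> \<le> norm ((1 / \<gamma>) *\<^sub>R X \<gamma> \<omega> - y)} \<subseteq> (\<Union>u\<in>?U. H \<gamma> u)"
    proof
      fix \<omega> assume "\<omega> \<in> {\<omega> \<in> space M. \<delta> \<le> norm ((1 / \<gamma>) *\<^sub>R X \<gamma> \<omega> - y)}"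
      then have \<omega>: "\<omega> \<in> space M" and far: "\<delta> \<le> norm ((1 / \<gamma>) *\<^sub>R X \<gamma> \<omega> - y)" by auto
      define z where "z = (1 / \<gamma>) *\<^sub>R X \<gamma> \<omega>"
      have "\<exists>i\<in>Basis. d \<le> \<bar>(z - y) \<bullet> i\<bar>"
      proof (rule ccontr)
        assume "\<not> ?thesis"
        then have less: "\<And>i. i \<in> Basis \<Longrightarrow> \<bar>(z - y) \<bullet> i\<bar> \<le> d" by force
        have "norm (z - y) \<le> (\<Sum>i\<in>Basis. \<bar>(z - y) \<bullet> i\<bar>)" by (rule norm_le_l1)
        also have "\<dots> \<le> (\<Sum>i\<in>(Basis :: 'v set). d)" by (intro sum_mono less)
        also have "\<dots> = \<delta> / 2" by (simp add: d_def)
        finally show False using far \<delta> unfolding z_def by linarith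
      qed
      then obtain i where i: "i \<in> Basis" "d \<le> \<bar>(z - y) \<bullet> i\<bar>" by auto
      have "i \<bullet> y + d \<le> i \<bullet> z \<or> (- i) \<bullet> y + d \<le> (- i) \<bullet> z"
      proof -
        have "(z - y) \<bullet> i = i \<bullet> z - i \<bullet> y"
          by (simp add: inner_diff_right inner_commute)
        then show ?thesis using i(2) unfolding inner_minus_left by linarith
      qed
      then have "\<omega> \<in> H \<gamma> i \<or> \<omega> \<in> H \<gamma> (- i)"
        using \<omega> unfolding H_def z_def by blast
      then show "\<omega> \<in> (\<Union>u\<in>?U. H \<gamma> u)" using i(1) by blast
    qed
    then have "measure (tilted_measure M X s \<gamma>) {\<omega> \<in> space M. \<delta> \<le> norm ((1 / \<gamma>) *\<^sub>R X \<gamma> \<omega> - y)}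
        \<le> measure (tilted_measure M X s \<gamma>) (\<Union>u\<in>?U. H \<gamma> u)"
      by (intro Q.finite_measure_mono sets.finite_UN H) auto
    also have "\<dots> \<le> (\<Sum>u\<in>?U. measure (tilted_measure M X s \<gamma>) (H \<gamma> u))"
      by (rule measure_UNION_le) (use H in auto)
    finally show ?case .
  qed
  ultimately show ?thesis by (rule exp_decaying_mono)
qed

text \<open>
  Change of measure: the tilted measure gives a small ball around \<^term>\<open>y\<close> probability at
  least one half, and on that ball its density is at most the exponential of \<^term>\<open>\<gamma>\<close> times the rate at
  \<^term>\<open>y\<close>, up to an error controlled by the radius. The three summands \<^term>\<open>\<eta> / 3\<close> pay for the radius, for the
  convergence of the cumulant generating function, and for the factor one half.
\<close>

lemma lower_bound_at_gradient:
  assumes grad: "has_gradient \<mu> s y" and y: "y \<in> interior E" and E[measurable]: "E \<in> sets borel" and \<eta>: "0 < \<eta>"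
  shows "\<forall>\<^sub>F \<gamma> in at_top. exp (- (s \<bullet> y - real_of_ereal (\<mu> s) + \<eta>) * \<gamma>) \<le> rare_event_prob M X E \<gamma>"
proof -
  obtain e where e: "0 < e" "ball y e \<subseteq> E" using y by (auto simp: mem_interior)
  define \<delta> where "\<delta> = min e (\<eta> / (3 * (norm s + 1)))"
  have pos: "0 < norm s + 1" by (simp add: add_nonneg_pos)
  have \<delta>: "0 < \<delta>" "\<delta> \<le> e" using e \<eta> pos by (auto simp: \<delta>_def)
  have s\<delta>: "norm s * \<delta> \<le> \<eta> / 3"
  proof -
    have "norm s * \<delta> \<le> (norm s + 1) * (\<eta> / (3 * (norm s + 1)))"
      using \<delta> by (intro mult_mono) (auto simp: \<delta>_def)
    also have "\<dots> = \<eta> / 3"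
      using pos by (metis less_irrefl mult.commute nonzero_divide_mult_cancel_left times_divide_eq_right mult_divide_mult_cancel_left)
    finally show ?thesis .
  qed
  have "\<forall>\<^sub>F \<gamma> in at_top. measure (tilted_measure M X s \<gamma>) {\<omega> \<in> space M. \<delta> \<le> norm ((1 / \<gamma>) *\<^sub>R X \<gamma> \<omega> - y)} < 1 / 2"
    by (rule exp_decaying_eventually_less[OF tilted_concentration[OF grad \<delta>(1)]]) simp
  moreover have "\<forall>\<^sub>F \<gamma> in at_top. real_of_ereal (\<mu> s) - \<eta> / 3 < real_of_ereal (scaled_cgf M X \<gamma> s)"
    using \<eta> by (intro order_tendstoD(1)[OF real_scaled_cgf_tendsto[OF grad]]) simp
  moreover have "\<forall>\<^sub>F \<gamma> in at_top. exp (- (\<eta> / 3) * \<gamma>) \<le> 1 / 2"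
    using \<eta> by real_asymp
  ultimately show ?thesis
    using eventually_prob_space_tilted[OF grad] eventually_gt_at_top[of 0]
  proof eventually_elim
    case (elim \<gamma>)
    interpret Q: prob_space "tilted_measure M X s \<gamma>" by (rule elim)
    note X_measurable[OF elim(5), measurable]
    let ?m = "real_of_ereal (scaled_cgf M X \<gamma> s)"
    let ?J = "s \<bullet> y - real_of_ereal (\<mu> s)"
    let ?p = "rare_event_prob M X E \<gamma>"
    define D where "D = {\<omega> \<in> space M. norm ((1 / \<gamma>) *\<^sub>R X \<gamma> \<omega> - y) < \<delta>}"
    have D[measurable]: "D \<in> sets M" unfolding D_def by measurable
    have "D = space (tilted_measure M X s \<gamma>) - {\<omega> \<in> space M. \<delta> \<le> norm ((1 / \<gamma>) *\<^sub>R X \<gamma> \<omega> - y)}"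
      by (auto simp: D_def)
    also have "measure (tilted_measure M X s \<gamma>) \<dots> =
        1 - measure (tilted_measure M X s \<gamma>) {\<omega> \<in> space M. \<delta> \<le> norm ((1 / \<gamma>) *\<^sub>R X \<gamma> \<omega> - y)}"
      by (rule Q.prob_compl) (unfold sets_tilted_measure, measurable)
    finally have half: "1 / 2 \<le> measure (tilted_measure M X s \<gamma>) D" using elim(1) by linarith
    have "emeasure (tilted_measure M X s \<gamma>) D
        = (\<integral>\<^sup>+ \<omega>. ennreal (exp (s \<bullet> X \<gamma> \<omega> - \<gamma> * ?m)) * indicator D \<omega> \<partial>M)"
      unfolding tilted_measure_def by (rule emeasure_density) measurable
    also have "\<dots> \<le> (\<integral>\<^sup>+ \<omega>. ennreal (exp ((?J + 2 * \<eta> / 3) * \<gamma>)) * indicator D \<omega> \<partial>M)"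
    proof (intro nn_integral_mono)
      fix \<omega>
      show "ennreal (exp (s \<bullet> X \<gamma> \<omega> - \<gamma> * ?m)) * indicator D \<omega>
          \<le> ennreal (exp ((?J + 2 * \<eta> / 3) * \<gamma>)) * indicator D \<omega>"
      proof (cases "\<omega> \<in> D")
        case True
        define z where "z = (1 / \<gamma>) *\<^sub>R X \<gamma> \<omega>"
        have "s \<bullet> (z - y) \<le> norm s * norm (z - y)" by (rule norm_cauchy_schwarz)
        also have "\<dots> \<le> norm s * \<delta>"
          using True by (intro mult_left_mono) (auto simp: D_def z_def)
        finally have "s \<bullet> z - ?m \<le> ?J + 2 * \<eta> / 3"
          using s\<delta> elim(2) by (simp add: inner_diff_right)
        then have "(s \<bullet> z - ?m) * \<gamma> \<le> (?J + 2 * \<eta> / 3) * \<gamma>"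
          using elim(5) by (intro mult_right_mono) auto
        moreover have "(s \<bullet> z - ?m) * \<gamma> = s \<bullet> X \<gamma> \<omega> - \<gamma> * ?m"
          using elim(5) by (simp add: z_def field_simps)
        ultimately show ?thesis by (intro mult_right_mono ennreal_leI) auto
      qed simp
    qed
    also have "\<dots> = ennreal (exp ((?J + 2 * \<eta> / 3) * \<gamma>) * measure M D)"
      by (simp add: nn_integral_cmult_indicator emeasure_eq_measure ennreal_mult)
    finally have "measure (tilted_measure M X s \<gamma>) D \<le> exp ((?J + 2 * \<eta> / 3) * \<gamma>) * measure M D"
      unfolding Q.emeasure_eq_measure by (simp add: ennreal_le_iff)
    also have "measure M D \<le> ?p"
      unfolding rare_event_prob_def
    proof (rule finite_measure_mono)
      show "D \<subseteq> {\<omega> \<in> space M. (1 / \<gamma>) *\<^sub>R X \<gamma> \<omega> \<in> E}"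
        using e(2) \<delta>(2) by (force simp: D_def dist_norm norm_minus_commute)
    qed measurable
    finally have "1 / 2 \<le> exp ((?J + 2 * \<eta> / 3) * \<gamma>) * ?p" using half by simp
    then have "exp (- (\<eta> / 3) * \<gamma>) \<le> exp ((?J + 2 * \<eta> / 3) * \<gamma>) * ?p" using elim(3) by linarith
    then have "exp (- (\<eta> / 3) * \<gamma>) * exp (- (?J + 2 * \<eta> / 3) * \<gamma>)
        \<le> exp ((?J + 2 * \<eta> / 3) * \<gamma>) * ?p * exp (- (?J + 2 * \<eta> / 3) * \<gamma>)"
      by (rule mult_right_mono) simp
    also have "\<dots> = ?p * exp ((?J + 2 * \<eta> / 3) * \<gamma> + - (?J + 2 * \<eta> / 3) * \<gamma>)"
      unfolding exp_add by (simp only: ac_simps)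
    also have "\<dots> = ?p"
      by (simp only: mult_minus_left add.right_inverse exp_zero mult_1_right)
    also have "exp (- (\<eta> / 3) * \<gamma>) * exp (- (?J + 2 * \<eta> / 3) * \<gamma>) = exp (- (?J + \<eta>) * \<gamma>)"
      unfolding exp_add[symmetric] by (simp add: algebra_simps add_divide_distrib[symmetric])
    finally show ?case .
  qed
qed

text \<open>
  The point \<^term>\<open>a\<close> may lie on the boundary of \<^term>\<open>E\<close>, where the preceding bound does not apply; it is
  applied to a nearby interior point, which is again a gradient and has almost the same rate.
\<close>

lemma rare_event_lower_bound:
  assumes diff: "\<And>x. x \<in> interior (eff_domain \<mu>) \<Longrightarrow> \<exists>g. has_gradient \<mu> x g"
    and grad: "has_gradient \<mu> s a" and uniq: "\<And>x. has_gradient \<mu> x a \<Longrightarrow> x = s"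
    and E: "E \<in> sets borel" and a: "a \<in> closure (interior E)" and \<eta>: "0 < \<eta>"
  shows "\<forall>\<^sub>F \<gamma> in at_top. exp (- (s \<bullet> a - real_of_ereal (\<mu> s) + \<eta>) * \<gamma>) \<le> rare_event_prob M X E \<gamma>"
proof -
  let ?J = "s \<bullet> a - real_of_ereal (\<mu> s)"
  obtain \<rho> K where \<rho>: "0 < \<rho>" "0 < K" and near: "\<And>y. norm (y - a) < \<rho> \<Longrightarrow>
       \<exists>x. has_gradient \<mu> x y \<and> x \<bullet> y - real_of_ereal (\<mu> x) \<le> ?J + K * norm (y - a)"
    using gradients_near[OF epi_convex_limit diff grad uniq] by blast
  have "0 < min \<rho> (\<eta> / (2 * K))" using \<rho> \<eta> by simp
  then obtain y where y: "y \<in> interior E" "dist y a < min \<rho> (\<eta> / (2 * K))"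
    using a unfolding closure_approachable by blast
  then obtain x where x: "has_gradient \<mu> x y" "x \<bullet> y - real_of_ereal (\<mu> x) \<le> ?J + K * norm (y - a)"
    using near[of y] by (auto simp: dist_norm)
  have "K * norm (y - a) \<le> \<eta> / 2" using y(2) \<rho> by (simp add: dist_norm field_simps)
  then have J: "x \<bullet> y - real_of_ereal (\<mu> x) + \<eta> / 2 \<le> ?J + \<eta>" using x(2) by linarith
  have "\<forall>\<^sub>F \<gamma> in at_top. exp (- (x \<bullet> y - real_of_ereal (\<mu> x) + \<eta> / 2) * \<gamma>) \<le> rare_event_prob M X E \<gamma>"
    using \<eta> by (intro lower_bound_at_gradient x(1) y(1) E) simp
  then show ?thesis using eventually_gt_at_top[of 0]
  proof eventually_elim
    case (elim \<gamma>)
    have "- (?J + \<eta>) * \<gamma> \<le> - (x \<bullet> y - real_of_ereal (\<mu> x) + \<eta> / 2) * \<gamma>"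
      using J elim(2) by (intro mult_right_mono) auto
    then show ?case using elim(1) by (meson exp_le_cancel_iff order_trans)
  qed
qed

text \<open>
  Positivity of the rate on \<^term>\<open>E\<close> passes to the point \<^term>\<open>a\<close> of the closure, since points of \<^term>\<open>E\<close> close to
  \<^term>\<open>a\<close> have a rate at most slightly above the one at \<^term>\<open>a\<close>.
\<close>

lemma rate_pos_on_closure:
  assumes diff: "\<And>x. x \<in> interior (eff_domain \<mu>) \<Longrightarrow> \<exists>g. has_gradient \<mu> x g"
    and grad: "has_gradient \<mu> s a" and uniq: "\<And>x. has_gradient \<mu> x a \<Longrightarrow> x = s"
    and a: "a \<in> closure E" and pos: "0 < rate_set \<mu> E"
  shows "0 < s \<bullet> a - real_of_ereal (\<mu> s)"
proof -
  let ?J = "s \<bullet> a - real_of_ereal (\<mu> s)"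
  obtain \<rho> K where \<rho>: "0 < \<rho>" "0 < K" and near: "\<And>y. norm (y - a) < \<rho> \<Longrightarrow>
       \<exists>x. has_gradient \<mu> x y \<and> x \<bullet> y - real_of_ereal (\<mu> x) \<le> ?J + K * norm (y - a)"
    using gradients_near[OF epi_convex_limit diff grad uniq] by blast
  obtain c where c: "0 < ereal c" "ereal c < rate_set \<mu> E" using ereal_dense2[OF pos] by blast
  have "0 < min \<rho> (c / K)" using \<rho> c by simp
  then obtain y where y: "y \<in> E" "dist y a < min \<rho> (c / K)"
    using a unfolding closure_approachable by blast
  then obtain x where x: "has_gradient \<mu> x y" "x \<bullet> y - real_of_ereal (\<mu> x) \<le> ?J + K * norm (y - a)"
    using near[of y] by (auto simp: dist_norm)
  have "K * norm (y - a) < c" using y(2) \<rho> by (simp add: dist_norm field_simps)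
  moreover have "ereal c < rate \<mu> y"
    using c(2) y(1) unfolding rate_set_def by (meson INF_lower less_le_trans)
  then have "c < x \<bullet> y - real_of_ereal (\<mu> x)"
    by (simp add: rate_at_gradient[OF epi_convex_limit x(1)])
  ultimately show ?thesis using x(2) by linarith
qed

section \<open>Importance weights\<close>

lemma RN_deriv_tilted_measure:
  assumes \<gamma>: "0 < \<gamma>" and fin: "scaled_cgf M X \<gamma> s = ereal (real_of_ereal (scaled_cgf M X \<gamma> s))"
  shows "AE \<omega> in tilted_measure M X s \<gamma>. enn2real (RN_deriv (tilted_measure M X s \<gamma>) M \<omega>)
      = exp (\<gamma> * real_of_ereal (scaled_cgf M X \<gamma> s) - s \<bullet> X \<gamma> \<omega>)"
proof -
  note X_measurable[OF \<gamma>, measurable]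
  let ?m = "real_of_ereal (scaled_cgf M X \<gamma> s)"
  interpret Q: prob_space "tilted_measure M X s \<gamma>"
    by (rule prob_space_tilted_measure[OF \<gamma> fin])
  have "density (tilted_measure M X s \<gamma>) (\<lambda>\<omega>. ennreal (exp (\<gamma> * ?m - s \<bullet> X \<gamma> \<omega>))) =
      density M (\<lambda>\<omega>. ennreal (exp (s \<bullet> X \<gamma> \<omega> - \<gamma> * ?m)) * ennreal (exp (\<gamma> * ?m - s \<bullet> X \<gamma> \<omega>)))"
    unfolding tilted_measure_def by (rule density_density_eq) measurable
  also have "\<dots> = M"
    by (simp add: density_1 flip: ennreal_mult exp_add)
  finally have "AE \<omega> in tilted_measure M X s \<gamma>. ennreal (exp (\<gamma> * ?m - s \<bullet> X \<gamma> \<omega>)) = RN_deriv (tilted_measure M X s \<gamma>) M \<omega>"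
    by (intro Q.RN_deriv_unique) (auto simp: tilted_measure_def)
  then show ?thesis by eventually_elim (metis enn2real_ennreal exp_ge_zero)
qed

lemma AE_tilted_measure_iff:
  assumes \<gamma>: "0 < \<gamma>"
  shows "(AE \<omega> in tilted_measure M X s \<gamma>. P \<omega>) \<longleftrightarrow> (AE \<omega> in M. P \<omega>)"
proof -
  note X_measurable[OF \<gamma>, measurable]
  show ?thesis unfolding tilted_measure_def by (subst AE_density) auto
qed

lemma integral_tilted_measure:
  assumes \<gamma>: "0 < \<gamma>" and G[measurable]: "G \<in> sets M"
  shows "(\<integral>\<omega>. indicator G \<omega> * exp (\<gamma> * real_of_ereal (scaled_cgf M X \<gamma> s) - s \<bullet> X \<gamma> \<omega>) \<partial>tilted_measure M X s \<gamma>)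
    = measure M G"
proof -
  note X_measurable[OF \<gamma>, measurable]
  let ?m = "real_of_ereal (scaled_cgf M X \<gamma> s)"
  have "(\<integral>\<omega>. indicator G \<omega> * exp (\<gamma> * ?m - s \<bullet> X \<gamma> \<omega>) \<partial>tilted_measure M X s \<gamma>)
      = (\<integral>\<omega>. exp (s \<bullet> X \<gamma> \<omega> - \<gamma> * ?m) *\<^sub>R (indicator G \<omega> * exp (\<gamma> * ?m - s \<bullet> X \<gamma> \<omega>)) \<partial>M)"
    unfolding tilted_measure_def by (rule integral_density) auto
  also have "\<dots> = (\<integral>\<omega>. indicator G \<omega> \<partial>M)"
    by (intro Bochner_Integration.integral_cong refl) (simp add: mult.left_commute flip: exp_add)
  also have "\<dots> = measure M G" by simp
  finally show ?thesis .
qed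

end

section \<open>Efficiency of tilting towards the most significant dominating point\<close>

lemma has_gradient_tilt: "\<exists>!s. has_gradient \<mu> s a \<Longrightarrow> has_gradient \<mu> (tilt \<mu> a) a"
  unfolding tilt_def by (rule theI')

theorem theorem5:
  fixes M :: "'a measure"
    and X :: "real \<Rightarrow> 'a \<Rightarrow> real ^ 'd"
    and \<mu> :: "real ^ 'd \<Rightarrow> ereal"
    and E A :: "(real ^ 'd) set"
    and a :: "real ^ 'd"
  assumes "prob_space M"
    and "\<And>\<gamma>. \<gamma> > 0 \<Longrightarrow> X \<gamma> \<in> borel_measurable M"
    and "assumption_A M X \<mu>"
    and "assumption_B \<mu> E"
    and "dominating_set \<mu> E A"
    and "a \<in> A"
    and "\<And>b. b \<in> A \<Longrightarrow> b \<noteq> a \<Longrightarrow> rate \<mu> a < rate \<mu> b"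
  shows "strongly_prob_efficient
           (\<lambda>\<gamma>. tilted_measure M X (tilt \<mu> a) \<gamma>)
           (\<lambda>\<gamma>. importance_estimator M (tilted_measure M X (tilt \<mu> a) \<gamma>) X E \<gamma>)
           (\<lambda>\<gamma>. rare_event_prob M X E \<gamma>)"
proof -
  interpret prob_space M by fact
  interpret scaled_cgf_limit M X \<mu>
    by unfold_locales (use assms(2,3) in \<open>auto simp: assumption_A_def\<close>)
  have diff: "\<And>x. x \<in> interior (eff_domain \<mu>) \<Longrightarrow> \<exists>g. has_gradient \<mu> x g"
    using assms(3) by (auto simp: assumption_A_def essentially_smooth_def)
  have E[measurable]: "E \<in> sets borel" and E_closure: "closure E = closure (interior E)"
    and E_rate: "0 < rate_set \<mu> E"
    using assms(4) by (auto simp: assumption_B_def)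
  have A: "finite A" "A \<subseteq> frontier E" and uniq_ex: "\<And>b. b \<in> A \<Longrightarrow> \<exists>!s. has_gradient \<mu> s b"
    and cover: "E \<subseteq> (\<Union>b\<in>A. {x. tilt \<mu> b \<bullet> (x - b) \<ge> 0})"
    using assms(5) by (auto simp: dominating_set_def covered_by_halfspaces_def)
  have grad: "has_gradient \<mu> (tilt \<mu> b) b" if "b \<in> A" for b
    using uniq_ex[OF that] by (rule has_gradient_tilt)
  have uniq: "x = tilt \<mu> b" if "b \<in> A" "has_gradient \<mu> x b" for x b
    using uniq_ex[OF that(1)] grad[OF that(1)] that(2) by blast

  \<comment> \<open>The bad set \<^term>\<open>B\<close> also collects the null set \<^term>\<open>N\<close> on which the Radon-Nikodym derivative differs
    from the explicit weight \<^term>\<open>w\<close>. The numerator of \<^term>\<open>R\<close> is the value of \<^term>\<open>w\<close> on the hyperplane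
    that bounds the half-space of \<^term>\<open>a\<close>.\<close>
  define s where "s = tilt \<mu> a"
  define J where "J b = tilt \<mu> b \<bullet> b - real_of_ereal (\<mu> (tilt \<mu> b))" for b
  define H where "H b \<gamma> = {\<omega> \<in> space M. tilt \<mu> b \<bullet> b \<le> tilt \<mu> b \<bullet> ((1 / \<gamma>) *\<^sub>R X \<gamma> \<omega>)}" for b \<gamma>
  define m where "m \<gamma> = real_of_ereal (scaled_cgf M X \<gamma> s)" for \<gamma>
  define w where "w \<gamma> \<omega> = exp (\<gamma> * m \<gamma> - s \<bullet> X \<gamma> \<omega>)" for \<gamma> \<omega>
  define Q where "Q \<gamma> = tilted_measure M X s \<gamma>" for \<gamma>
  define Z where "Z \<gamma> = importance_estimator M (Q \<gamma>) X E \<gamma>" for \<gamma>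
  define N where "N \<gamma> = {\<omega> \<in> space M. enn2real (RN_deriv (Q \<gamma>) M \<omega>) \<noteq> w \<gamma> \<omega>}" for \<gamma>
  define B where "B \<gamma> = (\<Union>b\<in>A - {a}. H b \<gamma>) \<union> N \<gamma>" for \<gamma>
  define V where "V \<gamma> = {\<omega> \<in> space M. (1 / \<gamma>) *\<^sub>R X \<gamma> \<omega> \<in> E}" for \<gamma>
  define p where "p \<gamma> = rare_event_prob M X E \<gamma>" for \<gamma>
  define R where "R \<gamma> = exp (\<gamma> * m \<gamma> - \<gamma> * (s \<bullet> a)) / p \<gamma>" for \<gamma>

  have p_eq: "p \<gamma> = measure M (V \<gamma>)" for \<gamma>
    by (simp add: p_def V_def rare_event_prob_def)
  have sets_Q: "sets (Q \<gamma>) = sets M" and space_Q: "space (Q \<gamma>) = space M" for \<gamma>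
    by (simp_all add: Q_def tilted_measure_def)
  have s: "has_gradient \<mu> s a" using grad[OF assms(6)] by (simp add: s_def)
  have Ja: "J a = s \<bullet> a - real_of_ereal (\<mu> s)" by (simp add: J_def s_def)
  have J_rate: "rate \<mu> b = ereal (J b)" if "b \<in> A" for b
    unfolding J_def by (rule rate_at_gradient[OF epi_convex_limit grad[OF that]])
  have J_less: "J a < J b" if "b \<in> A - {a}" for b
    using assms(7)[of b] that assms(6) by (simp add: J_rate)
  have Ja_pos: "0 < J a"
    unfolding Ja
  proof (rule rate_pos_on_closure[OF diff s])
    show "x = s" if "has_gradient \<mu> x a" for x
      using uniq[OF assms(6) that] by (simp add: s_def)
    show "a \<in> closure E" using A(2) assms(6) by (auto simp: frontier_def)
  qed (use E_rate in auto)
  have J_pos: "0 < J b" if "b \<in> A" for b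
    using J_less[of b] Ja_pos that by (cases "b = a") auto
  \<comment> \<open>Otherwise the affine minorant of the rate function given by \<^term>\<open>tilt \<mu> b\<close> would force \<^term>\<open>J a \<ge> J b\<close>.\<close>
  have a_notin: "tilt \<mu> b \<bullet> a < tilt \<mu> b \<bullet> b" if "b \<in> A - {a}" for b
  proof -
    have "tilt \<mu> b \<bullet> a - real_of_ereal (\<mu> (tilt \<mu> b)) \<le> J a"
      unfolding Ja by (rule gradient_supports[OF epi_convex_limit s])
        (use has_gradient_finite[OF grad[of b]] that in auto)
    then show ?thesis using J_less[OF that] by (simp add: J_def)
  qed

  have lower: "\<forall>\<^sub>F \<gamma> in at_top. exp (- (J a + \<eta>) * \<gamma>) \<le> p \<gamma>" if "0 < \<eta>" for \<eta>
    unfolding Ja p_def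
  proof (rule rare_event_lower_bound[OF diff s _ E _ that])
    show "x = s" if "has_gradient \<mu> x a" for x
      using uniq[OF assms(6) that] by (simp add: s_def)
    show "a \<in> closure (interior E)"
      using A(2) assms(6) E_closure by (auto simp: frontier_def)
  qed
  have H_decay: "\<forall>\<^sub>F \<gamma> in at_top. measure M (H b \<gamma>) \<le> exp (- \<theta> * \<gamma>)" if "b \<in> A" "\<theta> < J b" for b \<theta>
    unfolding H_def using that by (intro half_space_prob grad) (auto simp: J_def)
  have m_less: "\<forall>\<^sub>F \<gamma> in at_top. m \<gamma> < real_of_ereal (\<mu> s) + \<eta>" if "0 < \<eta>" for \<eta>
    unfolding m_def using that by (intro order_tendstoD(2)[OF real_scaled_cgf_tendsto[OF s]]) simp

  have H_meas: "H b \<gamma> \<in> sets M" if "0 < \<gamma>" for b \<gamma>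
  proof -
    note X_measurable[OF that, measurable]
    show ?thesis unfolding H_def by measurable
  qed
  have V_meas: "V \<gamma> \<in> sets M" if "0 < \<gamma>" for \<gamma>
  proof -
    note X_measurable[OF that, measurable]
    show ?thesis unfolding V_def by measurable
  qed
  have RN_meas: "RN_deriv (Q \<gamma>) M \<in> borel_measurable M" for \<gamma>
    using borel_measurable_RN_deriv[of "Q \<gamma>" M] by (simp add: measurable_cong_sets[OF sets_Q refl])
  have N_meas: "N \<gamma> \<in> sets M" if "0 < \<gamma>" for \<gamma>
  proof -
    note X_measurable[OF that, measurable] RN_meas[measurable]
    show ?thesis unfolding N_def w_def by measurable
  qed
  have B_meas: "B \<gamma> \<in> sets M" if "0 < \<gamma>" for \<gamma>
    unfolding B_def using A(1) by (intro sets.Un sets.finite_UN H_meas[OF that] N_meas[OF that]) simp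
  have Z_meas: "Z \<gamma> \<in> borel_measurable M" if "0 < \<gamma>" for \<gamma>
  proof -
    note X_measurable[OF that, measurable] RN_meas[measurable]
    show ?thesis unfolding Z_def importance_estimator_def by measurable
  qed
  have finite_cgf: "\<forall>\<^sub>F \<gamma> in at_top. 0 < \<gamma> \<and> scaled_cgf M X \<gamma> s = ereal (m \<gamma>)"
    using eventually_scaled_cgf_finite[OF s] eventually_gt_at_top[of 0]
    by eventually_elim (simp add: m_def)
  have N_null: "measure (Q \<gamma>) (N \<gamma>) = 0" "measure M (N \<gamma>) = 0"
    if "0 < \<gamma> \<and> scaled_cgf M X \<gamma> s = ereal (m \<gamma>)" for \<gamma>
  proof -
    have "AE \<omega> in Q \<gamma>. \<not> enn2real (RN_deriv (Q \<gamma>) M \<omega>) \<noteq> w \<gamma> \<omega>"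
      using RN_deriv_tilted_measure[of \<gamma> s] that unfolding Q_def w_def m_def by simp
    moreover from this have "AE \<omega> in M. \<not> enn2real (RN_deriv (Q \<gamma>) M \<omega>) \<noteq> w \<gamma> \<omega>"
      unfolding Q_def using that by (subst (asm) AE_tilted_measure_iff) auto
    ultimately show "measure (Q \<gamma>) (N \<gamma>) = 0" "measure M (N \<gamma>) = 0"
      using emeasure_eq_0_AE[of _ "Q \<gamma>"] emeasure_eq_0_AE[of _ M]
      by (auto simp: N_def measure_def space_Q)
  qed

  have "strongly_prob_efficient Q Z p"
  proof (rule strongly_prob_efficientI[where R = R and B = B])
    show "\<forall>\<^sub>F \<gamma> in at_top. prob_space (Q \<gamma>)"
      unfolding Q_def by (rule eventually_prob_space_tilted[OF s])
    show "\<forall>\<^sub>F \<gamma> in at_top. Z \<gamma> \<in> borel_measurable (Q \<gamma>)"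
      using eventually_gt_at_top[of 0]
      by eventually_elim (simp add: Z_meas measurable_cong_sets[OF sets_Q refl])
    show "\<forall>\<^sub>F \<gamma> in at_top. B \<gamma> \<in> sets (Q \<gamma>)"
      using eventually_gt_at_top[of 0] by eventually_elim (simp add: B_meas sets_Q)
    show p_pos: "\<forall>\<^sub>F \<gamma> in at_top. 0 < p \<gamma>"
      using lower[of 1] by (rule eventually_mono) (auto intro: less_le_trans[OF exp_gt_zero])
    then show "\<forall>\<^sub>F \<gamma> in at_top. 0 < R \<gamma>"
      by eventually_elim (simp add: R_def)
    \<comment> \<open>Outside the bad set the event lies in the half-space of \<^term>\<open>a\<close>, where the weight is largest on the bounding hyperplane.\<close>
    show "\<forall>\<^sub>F \<gamma> in at_top. \<forall>\<omega>\<in>space (Q \<gamma>) - B \<gamma>. 0 \<le> Z \<gamma> \<omega> \<and> Z \<gamma> \<omega> \<le> R \<gamma> * p \<gamma>"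
      using p_pos eventually_gt_at_top[of 0]
    proof eventually_elim
      case (elim \<gamma>)
      show ?case
      proof
        fix \<omega> assume "\<omega> \<in> space (Q \<gamma>) - B \<gamma>"
        then have \<omega>: "\<omega> \<in> space M" "\<omega> \<notin> B \<gamma>" by (auto simp: space_Q)
        have Z: "Z \<gamma> \<omega> = indicator E ((1 / \<gamma>) *\<^sub>R X \<gamma> \<omega>) * w \<gamma> \<omega>"
          using \<omega> by (simp add: Z_def importance_estimator_def B_def N_def)
        have "w \<gamma> \<omega> \<le> R \<gamma> * p \<gamma>" if V: "(1 / \<gamma>) *\<^sub>R X \<gamma> \<omega> \<in> E"
        proof -
          obtain b where b: "b \<in> A" "tilt \<mu> b \<bullet> ((1 / \<gamma>) *\<^sub>R X \<gamma> \<omega> - b) \<ge> 0"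
            using cover V by blast
          then have "\<omega> \<in> H b \<gamma>" using \<omega> by (simp add: H_def inner_diff_right)
          then have "b = a" using \<omega> b(1) by (auto simp: B_def)
          then have "\<gamma> * (s \<bullet> a) \<le> s \<bullet> X \<gamma> \<omega>"
            using b(2) elim by (simp add: s_def inner_diff_right field_simps)
          then show ?thesis using elim by (simp add: R_def w_def)
        qed
        moreover have "0 \<le> w \<gamma> \<omega>" "0 \<le> R \<gamma> * p \<gamma>"
          using elim by (simp_all add: w_def R_def)
        ultimately show "0 \<le> Z \<gamma> \<omega> \<and> Z \<gamma> \<omega> \<le> R \<gamma> * p \<gamma>"
          unfolding Z by (auto simp: indicator_def)
      qed
    qed
    show "\<forall>\<^sub>F \<gamma> in at_top. \<bar>(\<integral>\<omega>. indicator (space (Q \<gamma>) - B \<gamma>) \<omega> * Z \<gamma> \<omega> \<partial>Q \<gamma>) - p \<gamma>\<bar> \<le> \<delta> * p \<gamma>"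
      if \<delta>: "0 < \<delta>" for \<delta>
    proof -
      \<comment> \<open>The truncated mean misses the probability of the event inside the bad set, which is
        exponentially smaller than the whole, as the other half-spaces have larger rates.\<close>
      have "exp_decaying (\<lambda>\<gamma>. \<Sum>b\<in>A - {a}. measure M (H b \<gamma>) * exp (J a * \<gamma>))"
      proof (rule exp_decaying_sum)
        fix b assume b: "b \<in> A - {a}"
        define \<kappa> where "\<kappa> = (J b - J a) / 2"
        have \<kappa>: "0 < \<kappa>" "J a + \<kappa> < J b" using J_less[OF b] by (auto simp: \<kappa>_def field_simps)
        have "\<forall>\<^sub>F \<gamma> in at_top. measure M (H b \<gamma>) \<le> exp (- (J a + \<kappa>) * \<gamma>)"
          using b \<kappa> by (intro H_decay) auto
        then have "\<forall>\<^sub>F \<gamma> in at_top. measure M (H b \<gamma>) * exp (J a * \<gamma>) \<le> exp (- \<kappa> * \<gamma>)"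
        proof eventually_elim
          case (elim \<gamma>)
          then have "measure M (H b \<gamma>) * exp (J a * \<gamma>) \<le> exp (- (J a + \<kappa>) * \<gamma>) * exp (J a * \<gamma>)"
            by (rule mult_right_mono) simp
          also have "\<dots> = exp (- \<kappa> * \<gamma>)" by (simp add: algebra_simps flip: exp_add)
          finally show ?case .
        qed
        then show "exp_decaying (\<lambda>\<gamma>. measure M (H b \<gamma>) * exp (J a * \<gamma>))"
          using \<kappa>(1) by (auto simp: exp_decaying_def)
      qed (use A(1) in simp)
      then obtain \<kappa> where \<kappa>: "0 < \<kappa>"
        "\<forall>\<^sub>F \<gamma> in at_top. (\<Sum>b\<in>A - {a}. measure M (H b \<gamma>) * exp (J a * \<gamma>)) \<le> exp (- \<kappa> * \<gamma>)"
        by (auto simp: exp_decaying_def)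
      have "\<forall>\<^sub>F \<gamma> in at_top. exp (- (\<kappa> / 2) * \<gamma>) < \<delta>"
        by (rule exp_decaying_eventually_less[OF _ \<delta>]) (use \<kappa>(1) in \<open>auto simp: exp_decaying_def intro!: exI[of _ "\<kappa> / 2"]\<close>)
      moreover have "\<forall>\<^sub>F \<gamma> in at_top. exp (- (J a + \<kappa> / 2) * \<gamma>) \<le> p \<gamma>"
        using \<kappa>(1) by (intro lower) simp
      ultimately show ?thesis
        using \<kappa>(2) finite_cgf
      proof eventually_elim
        case (elim \<gamma>)
        have \<gamma>: "0 < \<gamma>" using elim by simp
        have "(\<integral>\<omega>. indicator (space (Q \<gamma>) - B \<gamma>) \<omega> * Z \<gamma> \<omega> \<partial>Q \<gamma>)
            = (\<integral>\<omega>. indicator (V \<gamma> - B \<gamma>) \<omega> * w \<gamma> \<omega> \<partial>Q \<gamma>)"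
          by (intro Bochner_Integration.integral_cong refl)
             (auto simp: space_Q V_def B_def N_def Z_def importance_estimator_def indicator_def)
        also have "\<dots> = measure M (V \<gamma> - B \<gamma>)"
          unfolding Q_def w_def m_def using V_meas[OF \<gamma>] B_meas[OF \<gamma>] by (intro integral_tilted_measure \<gamma>) auto
        finally have int: "(\<integral>\<omega>. indicator (space (Q \<gamma>) - B \<gamma>) \<omega> * Z \<gamma> \<omega> \<partial>Q \<gamma>) = measure M (V \<gamma> - B \<gamma>)" .
        have "p \<gamma> = measure M (V \<gamma> - B \<gamma>) + measure M (V \<gamma> \<inter> B \<gamma>)"
          unfolding p_eq using V_meas[OF \<gamma>] B_meas[OF \<gamma>]
          by (metis add.commute finite_measure_Diff' add_diff_cancel_right' diff_add_cancel)
        moreover have "measure M (V \<gamma> \<inter> B \<gamma>) \<le> measure M (B \<gamma>)"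
          using B_meas[OF \<gamma>] by (intro finite_measure_mono) auto
        moreover have "measure M (B \<gamma>) \<le> (\<Sum>b\<in>A - {a}. measure M (H b \<gamma>))"
        proof -
          have "measure M (B \<gamma>) \<le> measure M (\<Union>b\<in>A - {a}. H b \<gamma>) + measure M (N \<gamma>)"
            unfolding B_def using A(1)
            by (intro measure_Un_le sets.finite_UN H_meas[OF \<gamma>] N_meas[OF \<gamma>]) simp
          also have "measure M (\<Union>b\<in>A - {a}. H b \<gamma>) \<le> (\<Sum>b\<in>A - {a}. measure M (H b \<gamma>))"
            using H_meas[OF \<gamma>] A(1) by (intro measure_UNION_le) auto
          finally show ?thesis using N_null[OF elim(4)] by simp
        qed
        moreover have "(\<Sum>b\<in>A - {a}. measure M (H b \<gamma>)) \<le> \<delta> * p \<gamma>"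
        proof -
          have "(\<Sum>b\<in>A - {a}. measure M (H b \<gamma>)) = (\<Sum>b\<in>A - {a}. measure M (H b \<gamma>) * exp (J a * \<gamma>)) * exp (- (J a * \<gamma>))"
            by (simp add: sum_distrib_right mult.assoc flip: exp_add)
          also have "\<dots> \<le> exp (- \<kappa> * \<gamma>) * exp (- (J a * \<gamma>))"
            by (intro mult_right_mono elim) simp
          also have "\<dots> = exp (- (\<kappa> / 2) * \<gamma>) * exp (- (J a + \<kappa> / 2) * \<gamma>)"
            by (simp add: field_simps flip: exp_add)
          also have "\<dots> \<le> \<delta> * p \<gamma>"
            using elim \<delta> by (intro mult_mono) auto
          finally show ?thesis .
        qed
        moreover have "0 \<le> measure M (V \<gamma> \<inter> B \<gamma>)" by simp
        ultimately show ?case unfolding int by linarith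
      qed
    qed
    show "exp_decaying (\<lambda>\<gamma>. measure (Q \<gamma>) (B \<gamma>))"
    proof (rule exp_decaying_mono)
      show "exp_decaying (\<lambda>\<gamma>. \<Sum>b\<in>A - {a}. measure (Q \<gamma>) (H b \<gamma>))"
        unfolding Q_def H_def using A(1) a_notin
        by (intro exp_decaying_sum tilted_tail_decay[OF s]) auto
      show "\<forall>\<^sub>F \<gamma> in at_top. measure (Q \<gamma>) (B \<gamma>) \<le> (\<Sum>b\<in>A - {a}. measure (Q \<gamma>) (H b \<gamma>))"
        using finite_cgf
      proof eventually_elim
        case (elim \<gamma>)
        have \<gamma>: "0 < \<gamma>" using elim by simp
        have "measure (Q \<gamma>) (B \<gamma>) \<le> measure (Q \<gamma>) (\<Union>b\<in>A - {a}. H b \<gamma>) + measure (Q \<gamma>) (N \<gamma>)"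
          unfolding B_def using A(1)
          by (intro measure_Un_le sets.finite_UN) (simp_all add: sets_Q H_meas[OF \<gamma>] N_meas[OF \<gamma>])
        also have "measure (Q \<gamma>) (\<Union>b\<in>A - {a}. H b \<gamma>) \<le> (\<Sum>b\<in>A - {a}. measure (Q \<gamma>) (H b \<gamma>))"
          using H_meas[OF \<gamma>] A(1) by (intro measure_UNION_le) (auto simp: sets_Q)
        finally show ?case using N_null[OF elim] by simp
      qed
    qed
    show "\<forall>\<^sub>F \<gamma> in at_top. R \<gamma> \<le> exp (\<eta> * \<gamma>)" if \<eta>: "0 < \<eta>" for \<eta>
    proof -
      have "\<forall>\<^sub>F \<gamma> in at_top. exp (- (J a + \<eta> / 2) * \<gamma>) \<le> p \<gamma>"
        "\<forall>\<^sub>F \<gamma> in at_top. m \<gamma> < real_of_ereal (\<mu> s) + \<eta> / 2"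
        by (rule lower m_less; use \<eta> in simp)+
      then show ?thesis using p_pos eventually_gt_at_top[of 0]
      proof eventually_elim
        case (elim \<gamma>)
        have "m \<gamma> - s \<bullet> a \<le> \<eta> + - (J a + \<eta> / 2)"
          using elim(2) by (simp add: Ja)
        then have "(m \<gamma> - s \<bullet> a) * \<gamma> \<le> (\<eta> + - (J a + \<eta> / 2)) * \<gamma>"
          using elim(4) by (intro mult_right_mono) auto
        then have "exp (\<gamma> * m \<gamma> - \<gamma> * (s \<bullet> a)) \<le> exp (\<eta> * \<gamma>) * exp (- (J a + \<eta> / 2) * \<gamma>)"
          by (simp add: algebra_simps flip: exp_add)
        also have "\<dots> \<le> exp (\<eta> * \<gamma>) * p \<gamma>"
          by (intro mult_left_mono elim(1)) simp
        finally show ?case using elim(3) by (simp add: R_def pos_divide_le_eq)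
      qed
    qed
    show "exp_decaying p"
    proof (rule exp_decaying_mono)
      show "exp_decaying (\<lambda>\<gamma>. \<Sum>b\<in>A. measure M (H b \<gamma>))"
      proof (rule exp_decaying_sum[OF A(1)])
        fix b assume "b \<in> A"
        then show "exp_decaying (\<lambda>\<gamma>. measure M (H b \<gamma>))"
          using H_decay[of b "J b / 2"] J_pos[of b] unfolding exp_decaying_def by (intro exI[of _ "J b / 2"]) auto
      qed
      show "\<forall>\<^sub>F \<gamma> in at_top. p \<gamma> \<le> (\<Sum>b\<in>A. measure M (H b \<gamma>))"
        using eventually_gt_at_top[of 0]
      proof eventually_elim
        case (elim \<gamma>)
        have "V \<gamma> \<subseteq> (\<Union>b\<in>A. H b \<gamma>)"
          using cover by (auto simp: V_def H_def inner_diff_right dest!: subsetD)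
        then have "p \<gamma> \<le> measure M (\<Union>b\<in>A. H b \<gamma>)"
          unfolding p_eq using A(1) by (intro finite_measure_mono sets.finite_UN H_meas[OF elim]) auto
        also have "\<dots> \<le> (\<Sum>b\<in>A. measure M (H b \<gamma>))"
          using H_meas[OF elim] A(1) by (intro measure_UNION_le) auto
        finally show ?case .
      qed
    qed
  qed
  then show ?thesis by (simp add: Q_def[abs_def] Z_def[abs_def] p_def[abs_def] s_def)
qed

end
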